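(* The set $\mathcal{F}(\mathcal{P}^3)\subset\mathbb{Z}^3$ of $f$-vectors of all $3$-polytopes with the operation $x\boxplus'' y:=x+y-(1,0,1)$ forms an affine semigroup, where the modified addition can be realized by connected sum operations as follows: for any two $3$-polytopes $P,Q$ there are $3$-polytopes $\bar P,\bar Q$ with $f(\bar P)=f(P)$ and $f(\bar Q)=f(Q)$ such that the connected sum $\bar P\#\bar Q$ is a $3$-polytope with $f(\bar P\#\bar Q)=f(P)\boxplus'' f(Q)$.
   Context: For a $3$-polytope $P$ (3-dimensional convex polytope), $f(P)=(f_0,f_1,f_2)$ counts vertices, edges and 2-faces. An affine semigroup is a structure isomorphic to a subset of some $\mathbb{Z}^n$ closed under addition. A vertex of a $3$-polytope is simple if it lies in exactly three facets. If $P$ is a $3$-polytope with a simple vertex $v$ and $Q$ is a $3$-polytope with a triangle facet $F$, a connected sum $P\#Q$ is formed as follows: cut off $v$ from $P$ by a plane separating $v$ strictly from all other vertices, which creates a new triangle facet $G$ with $3$ new vertices in the truncated polytope $\hat P$; then, using a projective transformation $\pi$ (not sending any point of $Q$ to infinity) if necessary, glue so that $\pi(Q)\cap\hat P=\pi(F)=G$, the union $\hat P\cup\pi(Q)$ is convex, and all proper faces of $G$ are faces of the union; $P\#Q$ is this union. *)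

theory Defs
  imports "HOL-Analysis.Analysis"
begin

definition polytope3 :: "(real^3) set \<Rightarrow> bool" where
  "polytope3 P \<longleftrightarrow> polytope P \<and> aff_dim P = 3"

definition face_number :: "(real^3) set \<Rightarrow> nat \<Rightarrow> nat" where
  "face_number P k = card {F. F face_of P \<and> aff_dim F = int k}"

definition f_vector :: "(real^3) set \<Rightarrow> int \<times> int \<times> int" where
  "f_vector P = (int (face_number P 0), int (face_number P 1), int (face_number P 2))"

definition f_vectors3 :: "(int \<times> int \<times> int) set" where
  "f_vectors3 = {f_vector P |P. polytope3 P}"

definition boxplus'' :: "int \<times> int \<times> int \<Rightarrow> int \<times> int \<times> int \<Rightarrow> int \<times> int \<times> int"
    (infixl "\<boxplus>''''" 65) where
  "x \<boxplus>'' y = x + y - (1, 0, 1)"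

text \<open>The group of integer n-tuples, for n not fixed by a type: integer sequences that
  vanish from index n on, with pointwise addition.\<close>

definition int_tuples :: "nat \<Rightarrow> (nat \<Rightarrow> int) set" where
  "int_tuples n = {x. \<forall>i\<ge>n. x i = 0}"

definition affine_semigroup :: "'a set \<Rightarrow> ('a \<Rightarrow> 'a \<Rightarrow> 'a) \<Rightarrow> bool" where
  "affine_semigroup A add \<longleftrightarrow>
     (\<forall>x\<in>A. \<forall>y\<in>A. add x y \<in> A) \<and>
     (\<exists>n S \<phi>. S \<subseteq> int_tuples n \<and>
        (\<forall>s\<in>S. \<forall>t\<in>S. (\<lambda>i. s i + t i) \<in> S) \<and>
        bij_betw \<phi> A S \<and>
        (\<forall>x\<in>A. \<forall>y\<in>A. \<phi> (add x y) = (\<lambda>i. \<phi> x i + \<phi> y i)))"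

definition simple_vertex :: "real^3 \<Rightarrow> (real^3) set \<Rightarrow> bool" where
  "simple_vertex v P \<longleftrightarrow> v extreme_point_of P \<and> card {F. F facet_of P \<and> v \<in> F} = 3"

definition triangle_facet :: "(real^3) set \<Rightarrow> (real^3) set \<Rightarrow> bool" where
  "triangle_facet F Q \<longleftrightarrow> F facet_of Q \<and> 2 simplex F"

text \<open>A projective transformation is given by a linear automorphism \<open>L\<close> of homogeneous
  coordinates \<open>(x, t)\<close>, where \<open>x\<close> in affine space is identified with \<open>(x, 1)\<close>.  A point is
  sent to infinity iff the last coordinate of its image under \<open>L\<close> is 0; \<open>projective_map\<close>
  returns a junk value there.\<close>

definition projective_map :: "((real^3) \<times> real \<Rightarrow> (real^3) \<times> real) \<Rightarrow> real^3 \<Rightarrow> real^3" where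
  "projective_map L x = fst (L (x, 1)) /\<^sub>R snd (L (x, 1))"

definition admissible_projective ::
    "((real^3) \<times> real \<Rightarrow> (real^3) \<times> real) \<Rightarrow> (real^3) set \<Rightarrow> bool" where
  "admissible_projective L Q \<longleftrightarrow> linear L \<and> bij L \<and> (\<forall>x\<in>Q. snd (L (x, 1)) \<noteq> 0)"

text \<open>The result of a connected sum depends on the chosen vertex, plane, triangle and
  projective transformation, so it is a relation: \<open>R\<close> is a connected sum \<open>P # Q\<close>.
  The plane is \<open>a \<bullet> x = b\<close>.\<close>

definition connected_sum :: "(real^3) set \<Rightarrow> (real^3) set \<Rightarrow> (real^3) set \<Rightarrow> bool" where
  "connected_sum P Q R \<longleftrightarrow>
     polytope3 P \<and> polytope3 Q \<and>
     (\<exists>v a b F L P' G.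
        simple_vertex v P \<and> triangle_facet F Q \<and>
        a \<bullet> v > b \<and> (\<forall>w. w extreme_point_of P \<and> w \<noteq> v \<longrightarrow> a \<bullet> w < b) \<and>
        P' = P \<inter> {x. a \<bullet> x \<le> b} \<and>
        G = P \<inter> {x. a \<bullet> x = b} \<and>
        admissible_projective L Q \<and>
        projective_map L ` Q \<inter> P' = projective_map L ` F \<and>
        projective_map L ` F = G \<and>
        R = P' \<union> projective_map L ` Q \<and>
        convex R \<and>
        (\<forall>E. E face_of G \<and> E \<noteq> G \<longrightarrow> E face_of R))"

end

theory Submission
  imports Defs
begin

text \<open>
  The \<open>f\<close>-vectors of 3-polytopes are the integer points with \<open>f\<^sub>0 - f\<^sub>1 + f\<^sub>2 = 2\<close>, \<open>3 f\<^sub>0 \<le> 2 f\<^sub>1\<close> and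
  \<open>3 f\<^sub>2 \<le> 2 f\<^sub>1\<close>: starting from a tetrahedron, cutting off a simple vertex adds \<open>(2, 3, 1)\<close>, cutting it off by a
  plane through one neighbour adds \<open>(1, 2, 1)\<close>, and two cuts through neighbours add \<open>(1, 3, 2)\<close>.  All cuts stay
  close to one vertex, so every \<open>f\<close>-vector occurs inside any given tetrahedron, with a prescribed facet of the
  tetrahedron left intact.  If \<open>P\<close> has a simple vertex that is cut off along a triangle \<open>G\<close>, take the
  tetrahedron over \<open>G\<close> whose apex is an interior point of \<open>P\<close> in the cut-off part: a polytope inside it with facet
  \<open>G\<close> fits onto the truncated \<open>P\<close>, and the union is convex because it lies in the convex set \<open>P\<close>, in which every
  segment between the two parts passes through \<open>G\<close>.
\<close>

section \<open>Faces of plane and halfspace sections\<close>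

text \<open>Neither summand can be taken as given: an octahedron has no simple vertex and a cube has
  no triangle facet. Both are therefore replaced by realisations of the same \<open>f\<close>-vector
  with a prescribed local shape. Euler's relation eliminates the number of edges. With m vertices
  and n facets the inequalities become m + 4 \<le> 2 n and n + 4 \<le> 2 m. This region has its apex
  at (4, 4), the tetrahedron, and its integer points are (4, 4) plus sums of (2, 1), (1, 1) and (1,
  2), which are the gains of the three moves. The moves can be repeated without any record of the
  combinatorial type, because each leaves a simple vertex with explicit edge coordinates. All
  counting rests on one description of the faces of plane and halfspace sections. It gives the
  inductive step of Euler's relation, the vertex figures and the effect of a cut. Applied to the
  glued polytope from both sides of the gluing plane, it also recovers the two pieces.\<close>

definition crosses :: "'a::euclidean_space \<Rightarrow> real \<Rightarrow> 'a set \<Rightarrow> bool" where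
  "crosses a t F \<longleftrightarrow> (\<exists>x\<in>F. a \<bullet> x < t) \<and> (\<exists>x\<in>F. t < a \<bullet> x)"

text \<open>A face of least dimension through \<open>p\<close> works: the relative boundary of a
  polytope is the union of its facets, so otherwise \<open>p\<close> would lie on a smaller
  face.\<close>

lemma polytope_face_rel_interior:
  fixes P :: "'a::euclidean_space set"
  assumes "polytope P" "p \<in> P"
  obtains F where "F face_of P" "p \<in> rel_interior F"
proof -
  let ?Q = "\<lambda>F. F face_of P \<and> p \<in> F"
  have "?Q P"
    using assms by (simp add: face_of_refl polytope_imp_convex)
  then obtain F where F: "?Q F" and least: "\<And>G. ?Q G \<Longrightarrow> nat (aff_dim F + 1) \<le> nat (aff_dim G + 1)"
    using ex_has_least_nat[of ?Q P "\<lambda>F. nat (aff_dim F + 1)"] by blast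
  have "polytope F"
    using F assms face_of_polytope_polytope by blast
  have "p \<in> rel_interior F"
  proof (rule ccontr)
    assume "p \<notin> rel_interior F"
    then obtain G where G: "G facet_of F" "p \<in> G"
      using F rel_boundary_of_polyhedron[OF polytope_imp_polyhedron[OF \<open>polytope F\<close>]] by blast
    then have "?Q G"
      using F face_of_trans facet_of_imp_face_of by blast
    moreover have "aff_dim G = aff_dim F - 1" "G \<noteq> {}"
      using G by (auto simp: facet_of_def)
    ultimately show False
      using least[of G] aff_dim_geq[of F] aff_dim_geq[of G] by (smt (verit) aff_dim_empty nat_le_iff int_nat_eq)
  qed
  with F that show thesis by blast
qed

text \<open>A face is determined by any one of its relative interior points. If \<open>F\<close> is
  the face of \<open>P\<close> with \<open>p\<close> in its relative interior, then
  \<open>F \<inter> C\<close> is a face of \<open>P \<inter> C\<close> that has \<open>p\<close> in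
  its relative interior, as \<open>E\<close> does.\<close>

lemma face_of_Int_convex_cases:
  fixes P C :: "'a::euclidean_space set"
  assumes "polytope P" "convex C" "E face_of P \<inter> C" "p \<in> rel_interior E" "p \<in> rel_interior C"
  obtains F where "F face_of P" "p \<in> rel_interior F" "E = F \<inter> C"
proof -
  have "p \<in> P"
    using assms face_of_imp_subset rel_interior_subset by blast
  then obtain F where F: "F face_of P" "p \<in> rel_interior F"
    using polytope_face_rel_interior assms(1) by blast
  have "rel_interior (F \<inter> C) = rel_interior F \<inter> rel_interior C"
    using F assms face_of_imp_convex by (intro convex_rel_interior_inter_two) auto
  then have "E = F \<inter> C"
    using F assms by (intro face_of_eq[OF assms(3) face_of_slice]) auto
  with F that show thesis by blast
qed

lemma face_of_Int_convex_inj: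
  fixes P C :: "'a::euclidean_space set"
  assumes "convex C" "F face_of P" "G face_of P" "F \<inter> C = G \<inter> C"
    and "rel_interior F \<inter> rel_interior C \<noteq> {}" "rel_interior G \<inter> rel_interior C \<noteq> {}"
  shows "F = G"
proof -
  have "rel_interior F \<inter> rel_interior C = rel_interior G \<inter> rel_interior C"
    using assms face_of_imp_convex convex_rel_interior_inter_two by metis
  then show ?thesis
    using assms by (intro face_of_eq[OF assms(2,3)]) auto
qed

lemma rel_interior_meets_open:
  fixes F :: "'a::euclidean_space set"
  assumes "convex F" "open U" "F \<inter> U \<noteq> {}"
  shows "rel_interior F \<inter> U \<noteq> {}"
proof
  assume "rel_interior F \<inter> U = {}"
  then have "U \<inter> closure F = {}"
    using open_Int_closure_eq_empty[OF assms(2), of "rel_interior F"] convex_closure_rel_interior[OF assms(1)]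
    by (simp add: Int_commute)
  with assms(3) show False
    using closure_subset[of F] by blast
qed

text \<open>The relative interior is dense in \<open>F\<close>, so it has points on both sides, and
  it is connected.\<close>

lemma crosses_rel_interior:
  assumes "convex F" "crosses a t F"
  shows "rel_interior F \<inter> {x. a \<bullet> x = t} \<noteq> {}"
proof -
  have "F \<inter> {x. a \<bullet> x < t} \<noteq> {}" "F \<inter> {x. a \<bullet> x > t} \<noteq> {}"
    using assms by (auto simp: crosses_def)
  then obtain y z where y: "y \<in> rel_interior F" "a \<bullet> y < t" and z: "z \<in> rel_interior F" "a \<bullet> z > t"
    using rel_interior_meets_open[OF \<open>convex F\<close> open_halfspace_lt]
      rel_interior_meets_open[OF \<open>convex F\<close> open_halfspace_gt] by blast
  have "connected (rel_interior F)"
    using assms(1) convex_connected convex_rel_interior by blast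
  then show ?thesis
    using connected_ivt_hyperplane[of "rel_interior F" y z a t] y z by auto
qed

text \<open>A hyperplane that is not crossed supports \<open>F\<close> and cuts out a face of it; a
  face that meets the relative interior is all of \<open>F\<close>.\<close>

lemma crosses_or_subset_hyperplane:
  fixes a :: "'a::euclidean_space"
  assumes "convex F" "p \<in> rel_interior F" "a \<bullet> p = t"
  shows "F \<subseteq> {x. a \<bullet> x = t} \<or> crosses a t F"
proof (rule ccontr)
  assume "\<not> ?thesis"
  then have ns: "\<not> F \<subseteq> {x. a \<bullet> x = t}" and "(\<forall>x\<in>F. t \<le> a \<bullet> x) \<or> (\<forall>x\<in>F. a \<bullet> x \<le> t)"
    by (auto simp: crosses_def not_less)
  then have "F \<inter> {x. a \<bullet> x = t} face_of F"
    using assms(1) face_of_Int_supporting_hyperplane_le face_of_Int_supporting_hyperplane_ge by metis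
  moreover have "F \<inter> {x. a \<bullet> x = t} \<inter> rel_interior F \<noteq> {}"
    using assms rel_interior_subset[of F] by blast
  ultimately have "F \<subseteq> F \<inter> {x. a \<bullet> x = t}"
    by (rule subset_of_face_of[OF _ subset_refl])
  with ns show False by blast
qed

lemma crosses_face_section_not_face:
  assumes "convex P" "F face_of P" "crosses a t F" "G face_of P" "G \<subseteq> {x. a \<bullet> x = t}"
  shows "F \<inter> {x. a \<bullet> x = t} \<noteq> G"
proof
  assume G: "F \<inter> {x. a \<bullet> x = t} = G"
  have "rel_interior F \<inter> {x. a \<bullet> x = t} \<noteq> {}"
    using assms crosses_rel_interior face_of_imp_convex by blast
  then have "G \<inter> rel_interior F \<noteq> {}"
    using G rel_interior_subset[of F] by blast
  then have "F \<subseteq> G"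
    using assms(2) subset_of_face_of[OF assms(4)] face_of_imp_subset by blast
  with assms(3,5) show False by (fastforce simp: crosses_def)
qed

text \<open>Around a relative interior point on the hyperplane, \<open>F\<close> agrees with its
  affine hull, so the section of \<open>F\<close> spans the section of the affine hull.\<close>

lemma aff_dim_crosses_section:
  fixes a :: "'a::euclidean_space"
  assumes "convex F" "crosses a t F"
  shows "aff_dim (F \<inter> {x. a \<bullet> x = t}) = aff_dim F - 1"
proof -
  let ?H = "{x. a \<bullet> x = t}"
  have "rel_interior F \<inter> ?H \<noteq> {}"
    using assms crosses_rel_interior by blast
  then obtain p where p: "p \<in> rel_interior F" "p \<in> ?H" by blast
  have "affine hull (F \<inter> ?H) = affine hull F \<inter> ?H"
  proof
    show "affine hull (F \<inter> ?H) \<subseteq> affine hull F \<inter> ?H"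
      by (metis Int_greatest affine_hyperplane hull_minimal hull_mono inf_le1 inf_le2)
    obtain U where U: "open U" "rel_interior F = affine hull F \<inter> U"
      using openin_rel_interior[of F] by (auto simp: openin_open)
    have "affine (affine hull F \<inter> ?H)"
      by (simp add: affine_Int affine_hyperplane)
    moreover have "affine hull F \<inter> ?H \<inter> U \<noteq> {}"
      using p U by blast
    ultimately have "affine hull (affine hull F \<inter> ?H \<inter> U) = affine hull F \<inter> ?H"
      using affine_hull_affine_Int_open[OF _ U(1)] by (simp add: hull_same)
    moreover have "affine hull F \<inter> ?H \<inter> U \<subseteq> F \<inter> ?H"
      using U rel_interior_subset[of F] by blast
    ultimately show "affine hull F \<inter> ?H \<subseteq> affine hull (F \<inter> ?H)"
      by (metis hull_mono)
  qed
  then have "aff_dim (F \<inter> ?H) = aff_dim (affine hull F \<inter> ?H)"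
    by (metis aff_dim_affine_hull)
  moreover have "affine hull F \<inter> ?H \<noteq> {}"
    using p hull_subset[of F affine] rel_interior_subset[of F] by blast
  moreover have "\<not> affine hull F \<subseteq> ?H"
    using assms(2) hull_subset[of F affine] by (fastforce simp: crosses_def)
  ultimately show ?thesis
    using aff_dim_affine_Int_hyperplane[OF affine_affine_hull, of F a t] by simp
qed

lemma faces_hyperplane_section:
  fixes P :: "'a::euclidean_space set"
  assumes "polytope P"
  shows "{E. E face_of P \<inter> {x. a \<bullet> x = t} \<and> E \<noteq> {}} =
    {F. F face_of P \<and> F \<noteq> {} \<and> F \<subseteq> {x. a \<bullet> x = t}} \<union>
    (\<lambda>F. F \<inter> {x. a \<bullet> x = t}) ` {F. F face_of P \<and> crosses a t F}"
    (is "?L = ?A \<union> ?f ` ?B")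
proof
  let ?H = "{x. a \<bullet> x = t}"
  have H: "convex ?H" "rel_interior ?H = ?H"
    using rel_interior_affine[OF affine_hyperplane] convex_hyperplane by blast+
  show "?L \<subseteq> ?A \<union> ?f ` ?B"
  proof
    fix E assume E: "E \<in> ?L"
    then have "convex E" "E \<noteq> {}" "E \<subseteq> ?H"
      using face_of_imp_convex face_of_imp_subset by blast+
    then obtain p where p: "p \<in> rel_interior E"
      using rel_interior_eq_empty by blast
    then have pH: "p \<in> ?H"
      using \<open>E \<subseteq> ?H\<close> rel_interior_subset by blast
    obtain F where F: "F face_of P" "p \<in> rel_interior F" "E = F \<inter> ?H"
      using face_of_Int_convex_cases[OF assms H(1) _ p] E pH H(2) by blast
    then have "F \<subseteq> ?H \<or> crosses a t F"
      using pH crosses_or_subset_hyperplane face_of_imp_convex by blast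
    then show "E \<in> ?A \<union> ?f ` ?B"
      using F \<open>E \<noteq> {}\<close> by (auto simp: Int_absorb2)
  qed
  show "?A \<union> ?f ` ?B \<subseteq> ?L"
  proof -
    have "?A \<subseteq> ?L"
      by (auto intro: face_of_subset dest: face_of_imp_subset)
    moreover have "?f F \<in> ?L" if "F \<in> ?B" for F
      using that crosses_rel_interior[of F a t] rel_interior_subset[of F] face_of_imp_convex[of F]
      by (auto intro: face_of_slice[OF _ H(1)])
    ultimately show ?thesis by blast
  qed
qed

text \<open>The weight \<open>g\<close> stays arbitrary so that the alternating sign of Euler's
  relation and the indicator of a single dimension are both instances.\<close>

lemma sum_faces_hyperplane_section:
  fixes P :: "'a::euclidean_space set" and g :: "int \<Rightarrow> 'b::comm_monoid_add"
  assumes "polytope P"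
  shows "(\<Sum>E | E face_of P \<inter> {x. a \<bullet> x = t} \<and> E \<noteq> {}. g (aff_dim E)) =
    (\<Sum>F | F face_of P \<and> F \<noteq> {} \<and> F \<subseteq> {x. a \<bullet> x = t}. g (aff_dim F)) +
    (\<Sum>F | F face_of P \<and> crosses a t F. g (aff_dim F - 1))"
    (is "_ = sum _ ?A + sum _ ?B")
proof -
  let ?H = "{x. a \<bullet> x = t}"
  let ?f = "\<lambda>F. F \<inter> ?H"
  have fin: "finite ?A" "finite ?B"
    by (auto intro: finite_subset[OF _ finite_polytope_faces[OF assms]])
  have cv: "convex P"
    using assms polytope_imp_convex by blast
  have inj: "inj_on ?f ?B"
  proof (rule inj_onI)
    fix F G assume "F \<in> ?B" "G \<in> ?B" "?f F = ?f G"
    moreover from this have "rel_interior F \<inter> rel_interior ?H \<noteq> {}" "rel_interior G \<inter> rel_interior ?H \<noteq> {}"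
      using crosses_rel_interior face_of_imp_convex rel_interior_affine[OF affine_hyperplane, of a t]
      by (metis mem_Collect_eq)+
    ultimately show "F = G"
      using face_of_Int_convex_inj[OF convex_hyperplane] by blast
  qed
  have "?A \<inter> ?f ` ?B = {}"
  proof (rule ccontr)
    assume "?A \<inter> ?f ` ?B \<noteq> {}"
    then obtain F where "F \<in> ?B" "?f F \<in> ?A" by auto
    then show False
      using crosses_face_section_not_face[OF cv, of F a t "?f F"] by simp
  qed
  then have "(\<Sum>E | E face_of P \<inter> ?H \<and> E \<noteq> {}. g (aff_dim E)) =
      (\<Sum>F\<in>?A. g (aff_dim F)) + (\<Sum>E\<in>?f ` ?B. g (aff_dim E))"
    unfolding faces_hyperplane_section[OF assms] using fin by (simp add: sum.union_disjoint)
  also have "(\<Sum>E\<in>?f ` ?B. g (aff_dim E)) = (\<Sum>F\<in>?B. g (aff_dim F - 1))"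
    unfolding sum.reindex[OF inj] o_def
    by (intro sum.cong refl) (metis (mono_tags, lifting) aff_dim_crosses_section face_of_imp_convex mem_Collect_eq)
  finally show ?thesis .
qed

lemma card_eq_sum_if:
  assumes "finite A"
  shows "card {x \<in> A. Q x} = (\<Sum>x\<in>A. if Q x then 1 else 0)"
  using assms by (simp add: sum.inter_filter[symmetric])

lemma card_faces_hyperplane_section:
  fixes P :: "'a::euclidean_space set"
  assumes "polytope P"
  shows "card {E. E face_of P \<inter> {x. a \<bullet> x = t} \<and> aff_dim E = int k} =
    card {F. F face_of P \<and> aff_dim F = int k \<and> F \<subseteq> {x. a \<bullet> x = t}} +
    card {F. F face_of P \<and> aff_dim F = int k + 1 \<and> crosses a t F}"
proof -
  let ?H = "{x. a \<bullet> x = t}"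
  let ?g = "\<lambda>d. if d = int k then 1 else 0 :: nat"
  have fin: "finite {F. F face_of P \<and> Q F}" for Q
    by (auto intro: finite_subset[OF _ finite_polytope_faces[OF assms]])
  have fin': "finite {E. E face_of P \<inter> ?H \<and> E \<noteq> {}}"
    using polytope_Int_polyhedron[OF assms polyhedron_hyperplane]
    by (auto intro: finite_subset[OF _ finite_polytope_faces])
  have "card {E. E face_of P \<inter> ?H \<and> aff_dim E = int k} =
      card {E \<in> {E. E face_of P \<inter> ?H \<and> E \<noteq> {}}. aff_dim E = int k}"
    by (rule arg_cong[of _ _ card]) auto
  also have "\<dots> = (\<Sum>E | E face_of P \<inter> ?H \<and> E \<noteq> {}. ?g (aff_dim E))"
    by (rule card_eq_sum_if[OF fin'])
  also have "\<dots> = (\<Sum>F | F face_of P \<and> F \<noteq> {} \<and> F \<subseteq> ?H. ?g (aff_dim F)) +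
      (\<Sum>F | F face_of P \<and> crosses a t F. ?g (aff_dim F - 1))"
    by (rule sum_faces_hyperplane_section[OF assms])
  also have "(\<Sum>F | F face_of P \<and> F \<noteq> {} \<and> F \<subseteq> ?H. ?g (aff_dim F)) =
      card {F \<in> {F. F face_of P \<and> F \<noteq> {} \<and> F \<subseteq> ?H}. aff_dim F = int k}"
    by (rule card_eq_sum_if[OF fin, symmetric])
  also have "\<dots> = card {F. F face_of P \<and> aff_dim F = int k \<and> F \<subseteq> ?H}"
    by (rule arg_cong[of _ _ card]) auto
  also have "(\<Sum>F | F face_of P \<and> crosses a t F. ?g (aff_dim F - 1)) =
      card {F \<in> {F. F face_of P \<and> crosses a t F}. aff_dim F - 1 = int k}"
    by (rule card_eq_sum_if[OF fin, symmetric])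
  also have "\<dots> = card {F. F face_of P \<and> aff_dim F = int k + 1 \<and> crosses a t F}"
    by (rule arg_cong[of _ _ card]) auto
  finally show ?thesis .
qed

lemma halfspace_lt_subset_interior: "{x. a \<bullet> x < t} \<subseteq> interior {x. a \<bullet> x \<le> t}"
  by (rule interior_maximal) (auto simp: open_halfspace_lt)

text \<open>A face of the truncated polytope with a point strictly below the plane is the trace of
  exactly one face of \<open>P\<close>, of the same dimension. All others lie in the plane, and they
  are the faces of the section because the section is itself a face.\<close>

lemma card_faces_halfspace_section:
  fixes P :: "'a::euclidean_space set"
  assumes "polytope P"
  shows "card {E. E face_of P \<inter> {x. a \<bullet> x \<le> t} \<and> aff_dim E = int k} =
    card {F. F face_of P \<and> aff_dim F = int k \<and> (\<exists>x\<in>F. a \<bullet> x < t)} +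
    card {E. E face_of P \<inter> {x. a \<bullet> x = t} \<and> aff_dim E = int k}"
    (is "card ?L = card ?A + card ?B")
proof -
  let ?H = "{x. a \<bullet> x = t}" and ?K = "{x. a \<bullet> x \<le> t}"
  let ?f = "\<lambda>F. F \<inter> ?K"
  have cv: "convex P" "convex (P \<inter> ?K)" "convex ?K"
    using assms polytope_imp_convex convex_Int convex_halfspace_le by blast+
  have riK: "y \<in> rel_interior ?K" if "a \<bullet> y < t" for y
    using that halfspace_lt_subset_interior interior_subset_rel_interior by blast
  have ri: "\<exists>y \<in> rel_interior F. a \<bullet> y < t" if "convex F" "x \<in> F" "a \<bullet> x < t" for F x
    using rel_interior_meets_open[OF that(1) open_halfspace_lt, of a t] that by blast
  have PH: "P \<inter> ?H face_of P \<inter> ?K"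
  proof -
    have "P \<inter> ?K \<inter> ?H face_of P \<inter> ?K"
      using cv by (intro face_of_Int_supporting_hyperplane_le) auto
    moreover have "P \<inter> ?K \<inter> ?H = P \<inter> ?H" by auto
    ultimately show ?thesis by simp
  qed
  have fin: "finite ?A" "finite ?B"
    using polytope_Int_polyhedron[OF assms polyhedron_hyperplane]
    by (auto intro: finite_subset[OF _ finite_polytope_faces] assms)
  have inj: "inj_on ?f ?A"
  proof (rule inj_onI)
    fix F G assume FG: "F \<in> ?A" "G \<in> ?A" "?f F = ?f G"
    moreover from FG have "rel_interior F \<inter> rel_interior ?K \<noteq> {}" "rel_interior G \<inter> rel_interior ?K \<noteq> {}"
      using ri riK face_of_imp_convex by blast+
    ultimately show "F = G"
      using face_of_Int_convex_inj[of ?K F P G] cv by blast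
  qed
  have dim: "aff_dim (?f F) = aff_dim F" if "F face_of P" "y \<in> F" "a \<bullet> y < t" for F y
  proof -
    have "F \<inter> interior ?K \<noteq> {}"
      using that halfspace_lt_subset_interior by blast
    then have "affine hull (?f F) = affine hull F"
      using that face_of_imp_convex by (intro affine_hull_convex_Int_nonempty_interior) blast+
    then show ?thesis by (metis aff_dim_affine_hull)
  qed
  have "?L = ?f ` ?A \<union> ?B"
  proof
    show "?f ` ?A \<union> ?B \<subseteq> ?L"
      using dim face_of_slice[OF _ cv(3)] face_of_trans[OF _ PH] by auto
    show "?L \<subseteq> ?f ` ?A \<union> ?B"
    proof
      fix E assume E: "E \<in> ?L"
      then have cE: "convex E" "E \<subseteq> P \<inter> ?K"
        using face_of_imp_convex face_of_imp_subset by blast+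
      show "E \<in> ?f ` ?A \<union> ?B"
      proof (cases "E \<subseteq> ?H")
        case True
        then have "E face_of P \<inter> ?H"
          using E cE face_of_subset[of E "P \<inter> ?K" "P \<inter> ?H"] by fastforce
        with E show ?thesis by blast
      next
        case False
        then obtain x where "x \<in> E" "a \<bullet> x < t"
          using cE by force
        then obtain p where p: "p \<in> rel_interior E" "a \<bullet> p < t"
          using ri cE by blast
        then obtain F where F: "F face_of P" "p \<in> rel_interior F" "E = ?f F"
          using face_of_Int_convex_cases[OF assms cv(3) _ p(1) riK[OF p(2)]] E by blast
        have pF: "p \<in> F" using F rel_interior_subset by blast
        have "aff_dim F = aff_dim E"
          using F(3) dim[OF F(1) pF p(2)] by simp
        then have "F \<in> ?A"
          using E F(1) p(2) pF by auto
        with F show ?thesis by blast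
      qed
    qed
  qed
  moreover have "?f ` ?A \<inter> ?B = {}"
  proof -
    have "\<not> ?f F \<subseteq> ?H" if "F \<in> ?A" for F
      using that by fastforce
    then show ?thesis
      using face_of_imp_subset by blast
  qed
  ultimately show ?thesis
    using fin by (simp add: card_Un_disjoint card_image[OF inj])
qed

section \<open>Euler's relation\<close>

lemma polytope_level_range:
  fixes F :: "'a::euclidean_space set"
  assumes "polytope F" "F \<noteq> {}"
  obtains y z where "y extreme_point_of F" "z extreme_point_of F"
    "\<And>x. x \<in> F \<Longrightarrow> c \<bullet> y \<le> c \<bullet> x" "\<And>x. x \<in> F \<Longrightarrow> c \<bullet> x \<le> c \<bullet> z"
proof -
  define V where "V = {x. x extreme_point_of F}"
  have F: "F = convex hull V"
    using assms by (simp add: V_def Krein_Milman_Minkowski polytope_imp_compact polytope_imp_convex)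
  have fin: "finite V"
    unfolding V_def using assms finite_polyhedron_extreme_points polytope_imp_polyhedron by blast
  have "V \<noteq> {}"
    using F assms(2) by auto
  then have "Min ((\<bullet>) c ` V) \<in> (\<bullet>) c ` V" "Max ((\<bullet>) c ` V) \<in> (\<bullet>) c ` V"
    using fin by (auto intro!: Min_in Max_in)
  then obtain y z where yz: "y \<in> V" "c \<bullet> y = Min ((\<bullet>) c ` V)" "z \<in> V" "c \<bullet> z = Max ((\<bullet>) c ` V)"
    by (metis imageE)
  then have "V \<subseteq> {x. c \<bullet> y \<le> c \<bullet> x}" "V \<subseteq> {x. c \<bullet> x \<le> c \<bullet> z}"
    using fin by auto
  then have "convex hull V \<subseteq> {x. c \<bullet> y \<le> c \<bullet> x}" "convex hull V \<subseteq> {x. c \<bullet> x \<le> c \<bullet> z}"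
    using convex_halfspace_ge[of "c \<bullet> y" c] convex_halfspace_le[of c "c \<bullet> z"]
    by (simp_all only: hull_minimal)
  then show thesis
    using that[of y z] yz(1,3) F V_def by blast
qed

lemma finite_set_gap:
  fixes T :: "real set"
  assumes "finite T"
  obtains d where "d > 0" "\<And>s t. s \<in> T \<Longrightarrow> t \<in> T \<Longrightarrow> s < t \<Longrightarrow> s + d < t"
proof -
  define D where "D = insert 1 ((\<lambda>(s, t). t - s) ` {(s, t) \<in> T \<times> T. s < t})"
  have D: "finite D" "D \<noteq> {}"
    using assms by (auto simp: D_def intro!: finite_imageI intro: finite_subset[of _ "T \<times> T"])
  have pos: "0 < Min D"
    using D by (auto simp: D_def)
  have "s + Min D / 2 < t" if "s \<in> T" "t \<in> T" "s < t" for s t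
  proof -
    have "Min D \<le> t - s"
      using that D by (intro Min_le) (auto simp: D_def)
    with pos show ?thesis by simp
  qed
  with pos that[of "Min D / 2"] show thesis by simp
qed

lemma aff_dim_nonneg:
  fixes S :: "'a::euclidean_space set"
  assumes "S \<noteq> {}"
  shows "0 \<le> aff_dim S"
proof -
  have "aff_dim S \<noteq> -1"
    using assms aff_dim_empty by blast
  then show ?thesis
    using aff_dim_geq[of S] by linarith
qed

text \<open>Sweep a hyperplane across \<open>P\<close>.  Every face crosses exactly one more gap between consecutive
  vertex levels than vertex levels, unless it lies on one level.  Hence the alternating sum over the
  faces of \<open>P\<close> telescopes into the alternating sums of the sections at the vertex levels and just
  above them, which are known by induction.\<close>

theorem Euler_polytope:
  fixes P :: "'a::euclidean_space set"
  assumes "polytope P" "P \<noteq> {}"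
  shows "(\<Sum>F | F face_of P \<and> F \<noteq> {}. (-1) ^ nat (aff_dim F)) = (1::int)"
  using assms
proof (induction "nat (aff_dim P)" arbitrary: P rule: less_induct)
  case less
  note P = less.prems
  let ?e = "\<lambda>F::'a set. (-1) ^ nat (aff_dim F) :: int"
  have cv: "convex P"
    using P polytope_imp_convex by blast
  show ?case
  proof (cases "\<exists>x y. x \<in> P \<and> y \<in> P \<and> x \<noteq> y")
    case False
    with P obtain x where x: "P = {x}" by blast
    then have "{F. F face_of P \<and> F \<noteq> {}} = {{x}}"
      using face_of_imp_subset face_of_refl[OF cv] by auto
    then show ?thesis by simp
  next
    case True
    then obtain x y where xy: "x \<in> P" "y \<in> P" "x \<noteq> y" by blast
    \<comment> \<open>Any direction that is not constant on \<open>P\<close> will do; faces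
      contained in one level are recorded separately by \<open>L\<close>.\<close>
    define c where "c = y - x"
    have cxy: "c \<bullet> x \<noteq> c \<bullet> y"
      using xy inner_eq_zero_iff[of "y - x"] by (simp add: c_def inner_diff_right)
    define T where "T = (\<bullet>) c ` {x. x extreme_point_of P}"
    have finT: "finite T"
      unfolding T_def using P finite_polyhedron_extreme_points polytope_imp_polyhedron by blast
    \<comment> \<open>Smaller than every gap between levels: \<open>t + d\<close> lies strictly
      between the level \<open>t\<close> and the next one, or beyond the last.\<close>
    obtain d where d: "d > 0" "\<And>s t. s \<in> T \<Longrightarrow> t \<in> T \<Longrightarrow> s < t \<Longrightarrow> s + d < t"
      using finite_set_gap[OF finT] by blast
    define Fs where "Fs = {F. F face_of P \<and> F \<noteq> {}}"
    have finFs: "finite Fs"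
      unfolding Fs_def using finite_polytope_faces[OF P(1)] by (rule rev_finite_subset) auto
    define L where "L t = (\<Sum>F | F face_of P \<and> F \<noteq> {} \<and> F \<subseteq> {x. c \<bullet> x = t}. ?e F)" for t
    define X where "X t = (\<Sum>F | F face_of P \<and> crosses c t F. ?e F)" for t
    \<comment> \<open>The induction hypothesis for the section. A crossing face loses one dimension
      in the section, which turns its sign around.\<close>
    have sect: "L t - X t = 1" if ne: "P \<inter> {x. c \<bullet> x = t} \<noteq> {}" for t
    proof -
      let ?S = "P \<inter> {x. c \<bullet> x = t}"
      have "\<not> affine hull P \<subseteq> {v. c \<bullet> v = t}"
      proof
        assume "affine hull P \<subseteq> {v. c \<bullet> v = t}"
        then have "c \<bullet> x = t" "c \<bullet> y = t"
          using xy hull_subset[of P affine] by blast+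
        with cxy show False by simp
      qed
      moreover have "affine hull P \<inter> {v. c \<bullet> v = t} \<noteq> {}"
        using ne hull_subset[of P affine] by blast
      ultimately have "aff_dim (affine hull P \<inter> {v. c \<bullet> v = t}) = aff_dim P - 1"
        using aff_dim_affine_Int_hyperplane[OF affine_affine_hull, of P c t] by simp
      moreover have "aff_dim ?S \<le> aff_dim (affine hull P \<inter> {v. c \<bullet> v = t})"
        using hull_subset[of P affine] by (intro aff_dim_subset) blast
      ultimately have "aff_dim ?S < aff_dim P" by linarith
      moreover have "0 \<le> aff_dim ?S"
        using ne by (rule aff_dim_nonneg)
      ultimately have "(\<Sum>E | E face_of ?S \<and> E \<noteq> {}. ?e E) = 1"
        using P ne by (intro less.hyps polytope_Int_polyhedron polyhedron_hyperplane) auto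
      then have "1 = L t + (\<Sum>F | F face_of P \<and> crosses c t F. (-1) ^ nat (aff_dim F - 1))"
        unfolding L_def sum_faces_hyperplane_section[OF P(1), where g = "\<lambda>d. (-1) ^ nat d"] by simp
      also have "(\<Sum>F | F face_of P \<and> crosses c t F. (-1) ^ nat (aff_dim F - 1)) =
          (\<Sum>F | F face_of P \<and> crosses c t F. - ?e F)"
      proof (rule sum.cong[OF refl])
        fix F assume F: "F \<in> {F. F face_of P \<and> crosses c t F}"
        then have "aff_dim (F \<inter> {x. c \<bullet> x = t}) = aff_dim F - 1" "F \<inter> {x. c \<bullet> x = t} \<noteq> {}"
          using aff_dim_crosses_section[of F c t] crosses_rel_interior[of F c t] rel_interior_subset[of F]
            face_of_imp_convex by blast+
        then have "aff_dim F - 1 \<ge> 0"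
          using aff_dim_nonneg by metis
        then have "nat (aff_dim F) = Suc (nat (aff_dim F - 1))" by simp
        then show "(-1) ^ nat (aff_dim F - 1) = - ?e F" by simp
      qed
      finally show ?thesis
        by (simp add: X_def sum_negf)
    qed
    have range: "\<exists>lo\<in>T. \<exists>hi\<in>T. lo \<le> hi \<and> (\<forall>x\<in>F. lo \<le> c \<bullet> x \<and> c \<bullet> x \<le> hi) \<and> (\<forall>t. F \<subseteq> {x. c \<bullet> x = t} \<longleftrightarrow> lo = t \<and> hi = t) \<and>
        (\<forall>t. crosses c t F \<longleftrightarrow> lo < t \<and> t < hi)" if "F \<in> Fs" for F
    proof -
      have F: "F face_of P" "F \<noteq> {}" "polytope F"
        using that P face_of_polytope_polytope by (auto simp: Fs_def)
      obtain y z where yz: "y extreme_point_of F" "z extreme_point_of F"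
        "\<And>x. x \<in> F \<Longrightarrow> c \<bullet> y \<le> c \<bullet> x" "\<And>x. x \<in> F \<Longrightarrow> c \<bullet> x \<le> c \<bullet> z"
        using polytope_level_range[OF F(3,2)] by blast
      have mem: "y \<in> F" "z \<in> F" "c \<bullet> y \<in> T" "c \<bullet> z \<in> T"
        using yz extreme_point_of_face[OF F(1)] by (auto simp: T_def extreme_point_of_def)
      have "F \<subseteq> {x. c \<bullet> x = t} \<longleftrightarrow> c \<bullet> y = t \<and> c \<bullet> z = t" for t
        using mem yz(3,4) by (auto intro: antisym)
      moreover have "crosses c t F \<longleftrightarrow> c \<bullet> y < t \<and> t < c \<bullet> z" for t
        using mem yz(3,4) unfolding crosses_def by (meson le_less_trans less_le_trans)
      moreover have "c \<bullet> y \<le> c \<bullet> z" "\<forall>x\<in>F. c \<bullet> y \<le> c \<bullet> x \<and> c \<bullet> x \<le> c \<bullet> z"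
        using mem yz(3,4) by auto
      ultimately show ?thesis
        using mem(3,4) by (intro bexI[of _ "c \<bullet> y"] bexI[of _ "c \<bullet> z"] conjI allI)
    qed
    \<comment> \<open>If \<open>lo < hi\<close>, the two crossing terms differ only at
      \<open>t = lo\<close>; if \<open>lo = hi\<close>, only the first term is nonzero, again at
      \<open>t = lo\<close>.\<close>
    have one: "(\<Sum>t\<in>T. of_bool (F \<subseteq> {x. c \<bullet> x = t}) - of_bool (crosses c t F) +
        of_bool (crosses c (t + d) F)) = (1::int)" if F: "F \<in> Fs" for F
    proof -
      obtain lo hi where lh: "lo \<in> T" "hi \<in> T" "lo \<le> hi"
        "\<And>t. F \<subseteq> {x. c \<bullet> x = t} \<longleftrightarrow> lo = t \<and> hi = t" "\<And>t. crosses c t F \<longleftrightarrow> lo < t \<and> t < hi"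
        using range[OF F] by blast
      have shift: "lo < t + d \<and> t + d < hi \<longleftrightarrow> lo \<le> t \<and> t < hi" if "t \<in> T" for t
        using d(1) d(2)[OF that lh(1)] d(2)[OF that lh(2)] by linarith
      have "(\<Sum>t\<in>T. of_bool (F \<subseteq> {x. c \<bullet> x = t}) - of_bool (crosses c t F) +
          of_bool (crosses c (t + d) F)) =
          (\<Sum>t\<in>T. (if t = lo then 1 else 0) :: int)"
        using lh(3) by (intro sum.cong refl) (auto simp: lh(4,5) shift)
      also have "\<dots> = 1"
        using finT lh(1) by simp
      finally show ?thesis .
    qed
    have P_Fs: "P \<in> Fs"
      using P cv by (simp add: Fs_def face_of_refl)
    obtain lo hi where lh: "lo \<in> T" "hi \<in> T"
      "\<forall>x\<in>P. lo \<le> c \<bullet> x \<and> c \<bullet> x \<le> hi" "\<forall>t. crosses c t P \<longleftrightarrow> lo < t \<and> t < hi"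
      using range[OF P_Fs] by (elim bexE conjE)
    have level: "t \<le> hi \<and> lo \<le> t \<and> P \<inter> {x. c \<bullet> x = t} \<noteq> {}" if "t \<in> T" for t
      using that lh(3) by (auto simp: T_def extreme_point_of_def)
    have no_level: "L (t + d) = 0" if "t \<in> T" for t
    proof -
      have False if F: "F \<in> Fs" "F \<subseteq> {x. c \<bullet> x = t + d}" for F
      proof -
        obtain lo' where "lo' \<in> T" "lo' = t + d"
          using range[OF F(1)] F(2) by (elim bexE conjE) simp
        then have "t + d \<in> T" by simp
        then show False using d(1) d(2)[OF \<open>t \<in> T\<close>, of "t + d"] by simp
      qed
      then have "{F. F face_of P \<and> F \<noteq> {} \<and> F \<subseteq> {x. c \<bullet> x = t + d}} = {}"
        by (auto simp: Fs_def)
      then show ?thesis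
        unfolding L_def by (simp only: sum.empty)
    qed
    \<comment> \<open>Strictly between levels no face lies in the plane, so the section identity
      reads \<open>- X (t + d) = 1\<close>; above the top level nothing is crossed.\<close>
    have gap: "X (t + d) = (if t = hi then 0 else - 1)" if t: "t \<in> T" for t
    proof (cases "t = hi")
      case True
      have False if F: "F face_of P" "crosses c (t + d) F" for F
      proof -
        obtain x where "x \<in> F" "hi + d < c \<bullet> x"
          using F(2) True unfolding crosses_def by blast
        then show False
          using lh(3) face_of_imp_subset[OF F(1)] d(1) by fastforce
      qed
      then have "{F. F face_of P \<and> crosses c (t + d) F} = {}" by blast
      then show ?thesis
        unfolding X_def True by (simp only: sum.empty simp_thms if_True)
    next
      case False
      then have "lo < t + d" "t + d < hi"
        using level[OF t] d(1) d(2)[OF t lh(2)] by auto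
      then have "crosses c (t + d) P" by (simp add: lh(4))
      then have "P \<inter> {x. c \<bullet> x = t + d} \<noteq> {}"
        using crosses_rel_interior[OF cv] rel_interior_subset by blast
      then show ?thesis
        using sect[of "t + d"] no_level[OF t] False by simp
    qed
    have L_sum: "L t = (\<Sum>F\<in>Fs. ?e F * of_bool (F \<subseteq> {x. c \<bullet> x = t}))" for t
      unfolding L_def Fs_def using finFs
      by (intro sum.mono_neutral_cong_left) (auto simp: Fs_def)
    have X_sum: "X t = (\<Sum>F\<in>Fs. ?e F * of_bool (crosses c t F))" for t
      unfolding X_def Fs_def using finFs
      by (intro sum.mono_neutral_cong_left) (auto simp: Fs_def crosses_def)
    have "(\<Sum>F\<in>Fs. ?e F) = (\<Sum>F\<in>Fs. \<Sum>t\<in>T. ?e F * (of_bool (F \<subseteq> {x. c \<bullet> x = t}) -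
        of_bool (crosses c t F) + of_bool (crosses c (t + d) F)))"
      by (rule sum.cong[OF refl]) (simp only: sum_distrib_left[symmetric] one mult_1_right)
    also have "\<dots> = (\<Sum>t\<in>T. L t - X t + X (t + d))"
      unfolding L_sum X_sum
      by (subst sum.swap) (simp only: distrib_left right_diff_distrib sum.distrib sum_subtractf)
    \<comment> \<open>Every level contributes 1 - 1, except the highest, which contributes
      1.\<close>
    also have "\<dots> = (\<Sum>t\<in>T. if t = hi then 1 else 0)"
      using sect level gap by (intro sum.cong refl) auto
    also have "\<dots> = 1"
      using finT lh(2) by simp
    finally show ?thesis
      unfolding Fs_def .
  qed
qed

section \<open>Face numbers of 3-polytopes\<close>

lemma finite_faces_Collect:
  fixes P :: "'a::euclidean_space set"
  assumes "polytope P"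
  shows "finite {F. F face_of P \<and> Q F}"
  using finite_polytope_faces[OF assms] by (rule rev_finite_subset) blast

lemma finite_extreme_points:
  fixes P :: "'a::euclidean_space set"
  assumes "polytope P"
  shows "finite {x. x extreme_point_of P}"
  using assms finite_polyhedron_extreme_points polytope_imp_polyhedron by blast

lemma polytope_eq_hull_extreme_points:
  fixes P :: "'a::euclidean_space set"
  assumes "polytope P"
  shows "P = convex hull {x. x extreme_point_of P}"
  using assms by (intro Krein_Milman_Minkowski polytope_imp_compact polytope_imp_convex)

lemma face_number_top:
  assumes "convex P" "aff_dim P = int d"
  shows "face_number P d = 1"
proof -
  have "{F. F face_of P \<and> aff_dim F = int d} = {P}"
    using assms face_of_refl face_of_aff_dim_lt[of P] by force
  then show ?thesis by (simp add: face_number_def)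
qed

text \<open>Stated for every dimension inside the same ambient space, because edges, plane sections
  and 3-polytopes all use it. The term of \<open>P\<close> itself has moved to the right-hand
  side.\<close>

lemma Euler_face_number:
  assumes P: "polytope P" "aff_dim P = int d"
  shows "(\<Sum>k<d. (-1) ^ k * int (face_number P k)) = 1 - (-1) ^ d"
proof -
  let ?Fs = "{F. F face_of P \<and> F \<noteq> {}}"
  have cv: "convex P" using P polytope_imp_convex by blast
  have "P \<noteq> {}" using P(2) by auto
  have le: "aff_dim F \<le> int d" if "F \<in> ?Fs" for F
    using that face_of_imp_subset aff_dim_subset P(2) by (metis (no_types, lifting) mem_Collect_eq)
  have "1 = (\<Sum>F\<in>?Fs. (-1) ^ nat (aff_dim F) :: int)"
    using Euler_polytope[OF P(1) \<open>P \<noteq> {}\<close>] by simp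
  also have "\<dots> = (\<Sum>k\<le>d. \<Sum>F | F \<in> ?Fs \<and> nat (aff_dim F) = k. (-1) ^ nat (aff_dim F))"
    using le finite_faces_Collect[OF P(1)] by (intro sum.group[symmetric]) fastforce+
  also have "\<dots> = (\<Sum>k\<le>d. (-1) ^ k * int (face_number P k))"
  proof (rule sum.cong[OF refl])
    fix k
    have "F \<noteq> {} \<and> nat (aff_dim F) = k \<longleftrightarrow> aff_dim F = int k" for F :: "(real^3) set"
      using aff_dim_nonneg[of F] by (cases "F = {}") auto
    then have "{F \<in> ?Fs. nat (aff_dim F) = k} = {F. F face_of P \<and> aff_dim F = int k}"
      by (simp add: conj_assoc)
    moreover have "(\<Sum>F | F \<in> ?Fs \<and> nat (aff_dim F) = k. (-1) ^ nat (aff_dim F)) =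
        (\<Sum>F | F \<in> ?Fs \<and> nat (aff_dim F) = k. (-1) ^ k :: int)"
      by (rule sum.cong) auto
    ultimately show "(\<Sum>F | F \<in> ?Fs \<and> nat (aff_dim F) = k. (-1) ^ nat (aff_dim F)) =
        (-1) ^ k * int (face_number P k)"
      by (simp add: face_number_def)
  qed
  also have "\<dots> = (\<Sum>k<d. (-1) ^ k * int (face_number P k)) + (-1) ^ d"
    using face_number_top[OF cv P(2)] by (simp add: lessThan_Suc_atMost[symmetric])
  finally show ?thesis by simp
qed

lemma Euler_segment: "polytope P \<Longrightarrow> aff_dim P = 1 \<Longrightarrow> face_number P 0 = 2"
  using Euler_face_number[of P 1] by simp

lemma Euler_polygon: "polytope P \<Longrightarrow> aff_dim P = 2 \<Longrightarrow> face_number P 1 = face_number P 0"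
  using Euler_face_number[of P 2] by (simp add: numeral_2_eq_2)

lemma Euler_polytope3: "polytope3 P \<Longrightarrow> face_number P 0 + face_number P 2 = face_number P 1 + 2"
  using Euler_face_number[of P 3] by (simp add: polytope3_def numeral_3_eq_3 numeral_2_eq_2)

lemma face_number_0: "face_number P 0 = card {x. x extreme_point_of P}"
proof -
  have "{F. F face_of P \<and> aff_dim F = int 0} = (\<lambda>x. {x}) ` {x. x extreme_point_of P}"
    by (auto simp: aff_dim_eq_0 face_of_singleton[symmetric])
  then show ?thesis
    by (simp add: face_number_def card_image)
qed

lemma aff_dim_less_face_number:
  assumes "polytope P"
  shows "aff_dim P < int (face_number P 0)"
proof -
  have "aff_dim (convex hull {x. x extreme_point_of P}) \<le> int (face_number P 0) - 1"
    unfolding aff_dim_convex_hull face_number_0 by (rule aff_dim_le_card[OF finite_extreme_points[OF assms]])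
  then show ?thesis
    using polytope_eq_hull_extreme_points[OF assms] by simp
qed

text \<open>\<open>v\<close> is outside the hull of the other vertices: otherwise it would be
  extreme in that hull as well, hence one of the generating points.\<close>

lemma separate_extreme_point:
  fixes P :: "'a::euclidean_space set"
  assumes "polytope P" "v extreme_point_of P"
  shows "\<exists>a b. a \<bullet> v > b \<and> (\<forall>w. w extreme_point_of P \<and> w \<noteq> v \<longrightarrow> a \<bullet> w < b)"
proof -
  define V where "V = {x. x extreme_point_of P} - {v}"
  have "finite V" unfolding V_def using finite_extreme_points[OF assms(1)] by simp
  have VP: "convex hull V \<subseteq> P"
    using assms polytope_imp_convex by (intro hull_minimal) (auto simp: V_def extreme_point_of_def)
  have "v \<notin> convex hull V"
  proof
    assume v: "v \<in> convex hull V"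
    then have "v extreme_point_of convex hull V"
      using assms(2) VP by (auto simp: extreme_point_of_def)
    then show False
      using extreme_point_of_convex_hull by (auto simp: V_def)
  qed
  then obtain a b where "a \<bullet> v < b" "\<And>x. x \<in> convex hull V \<Longrightarrow> b < a \<bullet> x"
    using separating_hyperplane_closed_point[of "convex hull V" v] \<open>finite V\<close>
    by (auto simp: compact_imp_closed finite_imp_compact_convex_hull)
  then show ?thesis
    by (intro exI[of _ "- a"] exI[of _ "- b"]) (auto simp: V_def hull_inc)
qed

lemma another_extreme_point:
  fixes P :: "'a::euclidean_space set"
  assumes "polytope P" "1 \<le> aff_dim P"
  obtains u where "u extreme_point_of P" "u \<noteq> v"
proof -
  have "\<not> {x. x extreme_point_of P} \<subseteq> {v}"
  proof
    assume "{x. x extreme_point_of P} \<subseteq> {v}"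
    then have "aff_dim (convex hull {x. x extreme_point_of P}) \<le> aff_dim {v}"
      unfolding aff_dim_convex_hull by (rule aff_dim_subset)
    with assms show False
      using polytope_eq_hull_extreme_points[OF assms(1)] by simp
  qed
  then show thesis
    using that by blast
qed

text \<open>The section is the vertex figure of \<open>v\<close>. The plane passes through no
  vertex, so it contains no face, and a face of positive dimension crosses it exactly when it
  contains \<open>v\<close>, since it then has another vertex below.\<close>

lemma face_number_vertex_section:
  assumes P: "polytope P" and v: "v extreme_point_of P" "a \<bullet> v > b"
    and w: "\<forall>w. w extreme_point_of P \<and> w \<noteq> v \<longrightarrow> a \<bullet> w < b"
  shows "face_number (P \<inter> {x. a \<bullet> x = b}) k = card {F. F face_of P \<and> aff_dim F = int k + 1 \<and> v \<in> F}"
proof -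
  have not_level: False if "F face_of P" "aff_dim F = int k" "F \<subseteq> {x. a \<bullet> x = b}" for F
  proof -
    have "polytope F" "F \<noteq> {}"
      using that P face_of_polytope_polytope by auto
    then obtain x where "x extreme_point_of F"
      using polytope_level_range by blast
    then have "x extreme_point_of P" "x \<in> F"
      using extreme_point_of_face[OF that(1)] by blast+
    then show False using v w[rule_format, of x] that(3) by auto
  qed
  have cross: "crosses a b F \<longleftrightarrow> v \<in> F" if F: "F face_of P" "aff_dim F = int k + 1" for F
  proof -
    have F': "polytope F" "F \<noteq> {}"
      using F P face_of_polytope_polytope by auto
    obtain y z where yz: "y extreme_point_of F" "z extreme_point_of F"
      "\<And>x. x \<in> F \<Longrightarrow> a \<bullet> y \<le> a \<bullet> x" "\<And>x. x \<in> F \<Longrightarrow> a \<bullet> x \<le> a \<bullet> z"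
      using polytope_level_range[OF F'] by blast
    have yz': "y extreme_point_of P" "z extreme_point_of P" "y \<in> F" "z \<in> F"
      using yz extreme_point_of_face[OF F(1)] by auto
    show ?thesis
    proof
      assume "crosses a b F"
      then have "b < a \<bullet> z" using yz(4) by (force simp: crosses_def)
      then show "v \<in> F" using w[rule_format, of z] yz' by force
    next
      assume vF: "v \<in> F"
      obtain u where "u extreme_point_of F" "u \<noteq> v"
        using another_extreme_point[OF F'(1)] F(2) by auto
      then have "u \<in> F" "a \<bullet> u < b"
        using w extreme_point_of_face[OF F(1)] by auto
      then show "crosses a b F"
        using vF v(2) by (auto simp: crosses_def)
    qed
  qed
  have "{F. F face_of P \<and> aff_dim F = int k \<and> F \<subseteq> {x. a \<bullet> x = b}} = {}"
    using not_level by blast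
  moreover have "{F. F face_of P \<and> aff_dim F = int k + 1 \<and> crosses a b F} =
      {F. F face_of P \<and> aff_dim F = int k + 1 \<and> v \<in> F}"
    using cross by blast
  ultimately show ?thesis
    unfolding face_number_def card_faces_hyperplane_section[OF P] by (simp only: card.empty add_0_left)
qed

lemma aff_dim_vertex_section:
  fixes P :: "'a::euclidean_space set"
  assumes P: "polytope P" "aff_dim P \<ge> 1" and v: "v extreme_point_of P" "a \<bullet> v > b"
    and w: "\<forall>w. w extreme_point_of P \<and> w \<noteq> v \<longrightarrow> a \<bullet> w < b"
  shows "aff_dim (P \<inter> {x. a \<bullet> x = b}) = aff_dim P - 1"
proof -
  obtain u where "u extreme_point_of P" "u \<noteq> v"
    using another_extreme_point[OF P] by blast
  then have "crosses a b P"
    using v w[rule_format, of u] unfolding crosses_def extreme_point_of_def by blast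
  then show ?thesis
    using P polytope_imp_convex aff_dim_crosses_section by blast
qed

text \<open>The vertex figure is a polygon, whose vertices and edges correspond to the edges and
  facets through \<open>v\<close>. A polygon has equally many of both, and at least three.\<close>

lemma vertex_degree:
  assumes P: "polytope3 P" and v: "v extreme_point_of P"
  shows "card {F. F face_of P \<and> aff_dim F = 1 \<and> v \<in> F} = card {F. F face_of P \<and> aff_dim F = 2 \<and> v \<in> F}"
    and "3 \<le> card {F. F face_of P \<and> aff_dim F = 1 \<and> v \<in> F}"
proof -
  have P': "polytope P" "aff_dim P = 3"
    using P by (auto simp: polytope3_def)
  obtain a b where ab: "a \<bullet> v > b" "\<forall>w. w extreme_point_of P \<and> w \<noteq> v \<longrightarrow> a \<bullet> w < b"
    using separate_extreme_point[OF P'(1) v] by blast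
  let ?S = "P \<inter> {x. a \<bullet> x = b}"
  have "1 \<le> aff_dim P" using P'(2) by simp
  then have "aff_dim ?S = aff_dim P - 1"
    by (rule aff_dim_vertex_section[OF P'(1) _ v ab])
  then have S: "polytope ?S" "aff_dim ?S = 2"
    using P'(2) by (simp_all add: polytope_Int_polyhedron[OF P'(1) polyhedron_hyperplane])
  have "card {F. F face_of P \<and> aff_dim F = 1 \<and> v \<in> F} = face_number ?S 0"
    using face_number_vertex_section[OF P'(1) v ab, of 0] by (simp only: of_nat_0 add_0_left)
  moreover have "card {F. F face_of P \<and> aff_dim F = 2 \<and> v \<in> F} = face_number ?S 1"
    using face_number_vertex_section[OF P'(1) v ab, of 1] by (simp only: of_nat_1 one_add_one)
  moreover have "face_number ?S 1 = face_number ?S 0" "3 \<le> face_number ?S 0"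
    using Euler_polygon[OF S] aff_dim_less_face_number[OF S(1)] S(2) by linarith+
  ultimately show "card {F. F face_of P \<and> aff_dim F = 1 \<and> v \<in> F} = card {F. F face_of P \<and> aff_dim F = 2 \<and> v \<in> F}"
    "3 \<le> card {F. F face_of P \<and> aff_dim F = 1 \<and> v \<in> F}"
    by linarith+
qed

lemma sum_card_swap:
  assumes "finite A" "finite B"
  shows "(\<Sum>x\<in>A. card {y \<in> B. R x y}) = (\<Sum>y\<in>B. card {x \<in> A. R x y})"
  unfolding card_eq_sum_if[OF assms(1)] card_eq_sum_if[OF assms(2)] by (rule sum.swap)

lemma sum_vertex_incidences:
  assumes "polytope P"
  shows "(\<Sum>v | v extreme_point_of P. card {F. F face_of P \<and> aff_dim F = int k \<and> v \<in> F}) =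
    (\<Sum>F | F face_of P \<and> aff_dim F = int k. face_number F 0)"
proof -
  let ?A = "{v. v extreme_point_of P}" and ?B = "{F. F face_of P \<and> aff_dim F = int k}"
  have "(\<Sum>v\<in>?A. card {F. F face_of P \<and> aff_dim F = int k \<and> v \<in> F}) =
      (\<Sum>v\<in>?A. card {F \<in> ?B. v \<in> F})"
    by (simp add: conj_assoc)
  also have "\<dots> = (\<Sum>F\<in>?B. card {v \<in> ?A. v \<in> F})"
    using finite_extreme_points[OF assms] finite_faces_Collect[OF assms] by (rule sum_card_swap)
  also have "\<dots> = (\<Sum>F\<in>?B. face_number F 0)"
    by (intro sum.cong refl) (auto simp: face_number_0 extreme_point_of_face intro!: arg_cong[of _ _ card])
  finally show ?thesis .
qed

text \<open>Double counting. Edge degrees sum to twice the number of edges. Facets are counted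
  through their vertices, at least three each, and these incidences sum to the same number because
  edge and facet degrees agree at every vertex.\<close>

lemma face_number_inequalities:
  assumes P: "polytope3 P"
  shows "3 * face_number P 0 \<le> 2 * face_number P 1" "3 * face_number P 2 \<le> 2 * face_number P 1"
proof -
  have P': "polytope P" using P by (simp add: polytope3_def)
  let ?V = "{v. v extreme_point_of P}"
  let ?d = "\<lambda>k v. card {F. F face_of P \<and> aff_dim F = int k \<and> v \<in> F}"
  have "(\<Sum>F | F face_of P \<and> aff_dim F = int 1. face_number F 0) =
      (\<Sum>F | F face_of P \<and> aff_dim F = int 1. 2)"
    using P' face_of_polytope_polytope by (intro sum.cong refl) (auto intro!: Euler_segment)
  then have edges: "(\<Sum>v\<in>?V. ?d 1 v) = 2 * face_number P 1"
    using sum_vertex_incidences[OF P', of 1] by (simp add: face_number_def)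
  have "(\<Sum>v\<in>?V. 3) \<le> (\<Sum>v\<in>?V. ?d 1 v)"
    using vertex_degree(2)[OF P] by (intro sum_mono) simp
  then show "3 * face_number P 0 \<le> 2 * face_number P 1"
    unfolding edges by (simp add: face_number_0)
  have "3 * face_number P 2 = (\<Sum>F | F face_of P \<and> aff_dim F = int 2. 3)"
    by (simp add: face_number_def)
  also have "\<dots> \<le> (\<Sum>F | F face_of P \<and> aff_dim F = int 2. face_number F 0)"
    using P' face_of_polytope_polytope aff_dim_less_face_number by (intro sum_mono) fastforce
  also have "\<dots> = (\<Sum>v\<in>?V. ?d 2 v)"
    by (rule sum_vertex_incidences[OF P', symmetric])
  also have "\<dots> = (\<Sum>v\<in>?V. ?d 1 v)"
    using vertex_degree(1)[OF P] by (intro sum.cong refl) simp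
  finally show "3 * face_number P 2 \<le> 2 * face_number P 1"
    unfolding edges .
qed

section \<open>Cutting off a simple vertex\<close>

text \<open>A basis together with its dual basis: coordinates become inner products, so cutting
  planes and supporting functionals can be written down directly.\<close>

locale frame =
  fixes p q r A B C :: "real^3"
  assumes dual: "A \<bullet> p = 1" "A \<bullet> q = 0" "A \<bullet> r = 0" "B \<bullet> p = 0" "B \<bullet> q = 1" "B \<bullet> r = 0"
      "C \<bullet> p = 0" "C \<bullet> q = 0" "C \<bullet> r = 1"
    and span: "x = (A \<bullet> x) *\<^sub>R p + (B \<bullet> x) *\<^sub>R q + (C \<bullet> x) *\<^sub>R r"
begin

lemma coordinates: "x = v + (A \<bullet> (x - v)) *\<^sub>R p + (B \<bullet> (x - v)) *\<^sub>R q + (C \<bullet> (x - v)) *\<^sub>R r"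
  using span[of "x - v"] by (simp add: algebra_simps)

lemma coordinates_eqI:
  assumes "A \<bullet> (x - v) = A \<bullet> (y - v)" "B \<bullet> (x - v) = B \<bullet> (y - v)" "C \<bullet> (x - v) = C \<bullet> (y - v)"
  shows "x = y"
  by (subst coordinates[of x v], subst coordinates[of y v]) (simp only: assms)

lemma affine_hull_simplex: "affine hull {v, v + p, v + q, v + r} = UNIV"
proof -
  have "x \<in> affine hull {v, v + p, v + q, v + r}" for x
  proof -
    let ?S = "affine hull {v, v + p, v + q, v + r}"
    have v: "v \<in> ?S" "v + p \<in> ?S" "v + q \<in> ?S" "v + r \<in> ?S"
      by (simp_all add: hull_inc)
    have step: "y + c *\<^sub>R s \<in> ?S" if "y \<in> ?S" "v + s \<in> ?S" for y c s
    proof -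
      have "y + c *\<^sub>R ((v + s) - v) \<in> ?S"
        by (rule mem_affine_3_minus[OF affine_affine_hull that(1) that(2) v(1)])
      then show ?thesis by simp
    qed
    show ?thesis
      by (subst coordinates[of x v]) (intro step v)
  qed
  then show ?thesis by blast
qed

text \<open>At most four points that span dimension 3 must be distinct and independent.\<close>

lemma simplex_affine_independent:
  "\<not> affine_dependent {v, v + p, v + q, v + r}" "card {v, v + p, v + q, v + r} = 4"
proof -
  let ?S = "{v, v + p, v + q, v + r}"
  have d: "aff_dim ?S = 3"
    using affine_hull_simplex[of v] aff_dim_affine_hull[of ?S] by simp
  have "card ?S \<le> 4"
    by (simp add: card_insert_if)
  moreover have "aff_dim ?S \<le> int (card ?S) - 1"
    by (rule aff_dim_le_card) simp
  ultimately show c: "card ?S = 4" using d by linarith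
  show "\<not> affine_dependent ?S"
    unfolding affine_independent_iff_card using c d by simp
qed

lemma mem_simplex:
  assumes "0 \<le> A \<bullet> (x - v)" "0 \<le> B \<bullet> (x - v)" "0 \<le> C \<bullet> (x - v)"
    "A \<bullet> (x - v) + B \<bullet> (x - v) + C \<bullet> (x - v) \<le> 1"
  shows "x \<in> convex hull {v, v + p, v + q, v + r}"
proof -
  let ?S = "convex hull {v, v + p, v + q, v + r}"
  define w where "w = (\<lambda>i::nat. [1 - A \<bullet> (x - v) - B \<bullet> (x - v) - C \<bullet> (x - v), A \<bullet> (x - v), B \<bullet> (x - v), C \<bullet> (x - v)] ! i)"
  define y where "y = (\<lambda>i::nat. [v, v + p, v + q, v + r] ! i)"
  have nn: "0 \<le> w i" "y i \<in> ?S" if "i \<in> {..<4}" for i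
    using that assms by (auto simp: w_def y_def numeral_eq_Suc less_Suc_eq hull_inc)
  have "(\<Sum>i<4. w i) = 1"
    by (simp add: w_def numeral_eq_Suc)
  then have "(\<Sum>i<4. w i *\<^sub>R y i) \<in> ?S"
    using nn by (intro convex_sum) (auto simp: convex_convex_hull)
  also have "(\<Sum>i<4. w i *\<^sub>R y i) = v + (A \<bullet> (x - v)) *\<^sub>R p + (B \<bullet> (x - v)) *\<^sub>R q + (C \<bullet> (x - v)) *\<^sub>R r"
    by (simp add: w_def y_def numeral_eq_Suc algebra_simps)
  also have "\<dots> = x"
    by (rule coordinates[symmetric])
  finally show ?thesis .
qed

end

text \<open>A corner is a simple vertex \<open>v\<close> of \<open>Q\<close> with neighbours \<open>v + p\<close>, \<open>v + q\<close> and \<open>v + r\<close>; the functionals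
  \<open>A\<close>, \<open>B\<close>, \<open>C\<close> are the coordinates at \<open>v\<close> with respect to its three edge directions.\<close>

locale corner = frame +
  fixes Q :: "(real^3) set" and v :: "real^3"
  assumes polytope3: "polytope3 Q"
    and apex: "v \<in> Q"
    and cone: "\<forall>x\<in>Q. 0 \<le> A \<bullet> (x - v) \<and> 0 \<le> B \<bullet> (x - v) \<and> 0 \<le> C \<bullet> (x - v)"
    and neighbours: "v + p extreme_point_of Q" "v + q extreme_point_of Q" "v + r extreme_point_of Q"
begin

lemma polytope: "polytope Q" and aff_dim: "aff_dim Q = 3"
  using polytope3 by (auto simp: polytope3_def)

lemma convex: "convex Q"
  using polytope polytope_imp_convex by blast

lemma neighbours_in: "v + p \<in> Q" "v + q \<in> Q" "v + r \<in> Q"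
  using neighbours by (auto simp: extreme_point_of_def)

lemma simplex_subset: "convex hull {v, v + p, v + q, v + r} \<subseteq> Q"
  using apex neighbours_in convex by (intro hull_minimal) auto

lemma swap23: "corner p r q A C B Q v"
  using dual span polytope3 apex cone neighbours
  by unfold_locales (auto simp: add_ac)

lemma swap13: "corner r q p C B A Q v"
  using dual span polytope3 apex cone neighbours
  by unfold_locales (auto simp: add_ac)

text \<open>The plane meets the three edge lines at \<open>v + p / 2\<close>,
  \<open>v + q / m\<close> and \<open>v + r / n\<close>. A value 1 of \<open>m\<close> or
  \<open>n\<close> sends it through that neighbour. The fixed 2 always cuts the first edge in its
  interior, which is where the next corner arises. The minus sign puts \<open>v\<close> on the side
  removed by \<open>\<le>\<close>, as in \<open>connected_sum\<close>.\<close>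

definition cut_normal :: "real \<Rightarrow> real \<Rightarrow> real^3" where
  "cut_normal m n = - (2 *\<^sub>R A + m *\<^sub>R B + n *\<^sub>R C)"

definition cut_level :: "real \<Rightarrow> real \<Rightarrow> real" where
  "cut_level m n = cut_normal m n \<bullet> v - 1"

definition cut :: "real \<Rightarrow> real \<Rightarrow> (real^3) set" where
  "cut m n = Q \<inter> {x. cut_normal m n \<bullet> x \<le> cut_level m n}"

lemma cut_normal_inner:
  "cut_normal m n \<bullet> x - cut_level m n = 1 - (2 * (A \<bullet> (x - v)) + m * (B \<bullet> (x - v)) + n * (C \<bullet> (x - v)))"
  by (simp add: cut_normal_def cut_level_def inner_diff_right inner_add_left algebra_simps)

definition cut_face :: "real \<Rightarrow> real \<Rightarrow> (real^3) set" where
  "cut_face m n = Q \<inter> {x. cut_normal m n \<bullet> x = cut_level m n}"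

lemma polytope3_cut: "polytope3 (cut m n)"
proof -
  have "polytope (cut m n)"
    unfolding cut_def by (intro polytope_Int_polyhedron polytope polyhedron_halfspace_le)
  moreover have "v + p \<in> Q \<inter> interior {x. cut_normal m n \<bullet> x \<le> cut_level m n}"
    using neighbours_in(1) cut_normal_inner[of m n "v + p"] halfspace_lt_subset_interior
    by (fastforce simp: dual)
  then have "affine hull (cut m n) = affine hull Q"
    unfolding cut_def by (intro affine_hull_convex_Int_nonempty_interior convex) blast
  then have "aff_dim (cut m n) = 3"
    using aff_dim by (metis aff_dim_affine_hull)
  ultimately show ?thesis
    by (simp add: polytope3_def)
qed

lemma mem_Q:
  assumes "0 \<le> s" "0 \<le> t" "0 \<le> u" "s + t + u \<le> 1"
  shows "v + s *\<^sub>R p + t *\<^sub>R q + u *\<^sub>R r \<in> Q"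
  using assms simplex_subset mem_simplex[of "v + s *\<^sub>R p + t *\<^sub>R q + u *\<^sub>R r" v]
  by (auto simp: inner_add_right dual)

lemma mem_cut: "x \<in> cut m n \<longleftrightarrow> x \<in> Q \<and> 1 \<le> (2 *\<^sub>R A + m *\<^sub>R B + n *\<^sub>R C) \<bullet> (x - v)"
  using cut_normal_inner[of m n x] by (auto simp: cut_def inner_add_left)

lemma cut_swap23: "corner.cut A C B Q v n m = cut m n"
  unfolding corner.cut_def[OF swap23] corner.cut_level_def[OF swap23] corner.cut_normal_def[OF swap23]
    cut_def cut_level_def cut_normal_def by (simp add: add_ac)

text \<open>Relative to \<open>v\<close>, the cut satisfies \<open>?N \<ge> 1\<close>,
  \<open>A \<ge> 0\<close> and \<open>C \<ge> 0\<close>. The sum of the three functionals is least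
  exactly where all are tight, which is this one point.\<close>

lemma cut_vertex:
  assumes mn: "1 \<le> m" "1 \<le> n"
  shows "v + q /\<^sub>R m extreme_point_of cut m n"
proof -
  let ?N = "2 *\<^sub>R A + m *\<^sub>R B + n *\<^sub>R C"
  show ?thesis
  proof (rule extreme_point_of_Int_supporting_hyperplane_ge)
    show "cut m n \<inter> {x. (?N + A + C) \<bullet> x = (?N + A + C) \<bullet> v + 1} = {v + q /\<^sub>R m}"
    proof (intro equalityI subsetI)
      fix x assume x: "x \<in> cut m n \<inter> {x. (?N + A + C) \<bullet> x = (?N + A + C) \<bullet> v + 1}"
      then have "?N \<bullet> (x - v) + A \<bullet> (x - v) + C \<bullet> (x - v) = 1"
        by (simp add: inner_add_left inner_diff_right algebra_simps)
      moreover have "1 \<le> ?N \<bullet> (x - v)" "0 \<le> A \<bullet> (x - v)" "0 \<le> C \<bullet> (x - v)"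
        using x cone by (auto simp: mem_cut)
      ultimately have "A \<bullet> (x - v) = 0" "C \<bullet> (x - v) = 0" "?N \<bullet> (x - v) = 1"
        by linarith+
      moreover from this have "B \<bullet> (x - v) = 1 / m"
        using mn by (simp add: inner_add_left field_simps)
      ultimately have "x = v + q /\<^sub>R m"
        by (intro coordinates_eqI[of x v]) (simp_all add: dual inverse_eq_divide)
      then show "x \<in> {v + q /\<^sub>R m}" by simp
    next
      fix x assume "x \<in> {v + q /\<^sub>R m}"
      then show "x \<in> cut m n \<inter> {x. (?N + A + C) \<bullet> x = (?N + A + C) \<bullet> v + 1}"
        using mn mem_Q[of 0 "1 / m" 0] by (simp add: mem_cut inner_add_left inner_add_right dual distrib_left inverse_eq_divide)
    qed
    show "(?N + A + C) \<bullet> v + 1 \<le> (?N + A + C) \<bullet> x" if "x \<in> cut m n" for x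
    proof -
      have "1 \<le> ?N \<bullet> (x - v)" "0 \<le> A \<bullet> (x - v)" "0 \<le> C \<bullet> (x - v)"
        using that cone by (auto simp: mem_cut)
      then show ?thesis
        by (simp add: inner_add_left inner_diff_right algebra_simps)
    qed
  qed
qed

text \<open>This is what allows cuts to be repeated. The new apex is the point where the first edge
  is cut. Its facets lie in the cutting plane and in the two old facet planes through that edge, so
  the new coordinates are the cutting functional and multiples of \<open>B\<close> and
  \<open>C\<close>. Its neighbours are \<open>v + p\<close> and the other two points of the
  cut.\<close>

lemma corner_cut:
  assumes mn: "1 \<le> m" "1 \<le> n"
  shows "corner (p /\<^sub>R 2) (q /\<^sub>R m - p /\<^sub>R 2) (r /\<^sub>R n - p /\<^sub>R 2)
    (2 *\<^sub>R A + m *\<^sub>R B + n *\<^sub>R C) (m *\<^sub>R B) (n *\<^sub>R C) (cut m n) (v + p /\<^sub>R 2)"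
proof -
  let ?N = "2 *\<^sub>R A + m *\<^sub>R B + n *\<^sub>R C"
  note N = mem_cut[of _ m n]
  have pts: "v + p /\<^sub>R 2 \<in> cut m n" "v + p \<in> cut m n" "v + q /\<^sub>R m \<in> cut m n" "v + r /\<^sub>R n \<in> cut m n"
    using mn neighbours_in mem_Q[of "1/2" 0 0] mem_Q[of 0 "1/m" 0] mem_Q[of 0 0 "1/n"]
    by (auto simp: N inner_add_left inner_add_right dual divide_simps)
  have ex1: "v + p extreme_point_of cut m n"
    using neighbours(1) pts(2) by (auto simp: extreme_point_of_def N)
  have ex2: "v + q /\<^sub>R m extreme_point_of cut m n"
    by (rule cut_vertex[OF mn])
  have ex3: "v + r /\<^sub>R n extreme_point_of cut m n"
    using corner.cut_vertex[OF swap23 mn(2,1)] by (simp add: cut_swap23)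
  show ?thesis
  proof (unfold_locales)
    fix x :: "real^3"
    have "(?N \<bullet> x) *\<^sub>R (p /\<^sub>R 2) = (A \<bullet> x) *\<^sub>R p + (m * (B \<bullet> x) / 2) *\<^sub>R p + (n * (C \<bullet> x) / 2) *\<^sub>R p"
      by (simp only: scaleR_scaleR flip: scaleR_add_left) (simp add: inner_add_left field_simps)
    moreover have "(m *\<^sub>R B \<bullet> x) *\<^sub>R (q /\<^sub>R m - p /\<^sub>R 2) = (B \<bullet> x) *\<^sub>R q - (m * (B \<bullet> x) / 2) *\<^sub>R p"
      using mn by (simp add: scaleR_diff_right)
    moreover have "(n *\<^sub>R C \<bullet> x) *\<^sub>R (r /\<^sub>R n - p /\<^sub>R 2) = (C \<bullet> x) *\<^sub>R r - (n * (C \<bullet> x) / 2) *\<^sub>R p"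
      using mn by (simp add: scaleR_diff_right)
    ultimately have "(?N \<bullet> x) *\<^sub>R (p /\<^sub>R 2) + (m *\<^sub>R B \<bullet> x) *\<^sub>R (q /\<^sub>R m - p /\<^sub>R 2) +
        (n *\<^sub>R C \<bullet> x) *\<^sub>R (r /\<^sub>R n - p /\<^sub>R 2) = (A \<bullet> x) *\<^sub>R p + (B \<bullet> x) *\<^sub>R q + (C \<bullet> x) *\<^sub>R r"
      by simp
    then show "x = (?N \<bullet> x) *\<^sub>R (p /\<^sub>R 2) + (m *\<^sub>R B \<bullet> x) *\<^sub>R (q /\<^sub>R m - p /\<^sub>R 2) + (n *\<^sub>R C \<bullet> x) *\<^sub>R (r /\<^sub>R n - p /\<^sub>R 2)"
      using span[of x] by simp
  next
    show "polytope3 (cut m n)" by (rule polytope3_cut)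
  next
    show "v + p /\<^sub>R 2 \<in> cut m n" by (rule pts)
  next
    show "v + p /\<^sub>R 2 + p /\<^sub>R 2 extreme_point_of cut m n"
      using ex1 by (simp add: add.assoc flip: scaleR_add_left)
  next
    show "v + p /\<^sub>R 2 + (q /\<^sub>R m - p /\<^sub>R 2) extreme_point_of cut m n"
      using ex2 by simp
  next
    show "v + p /\<^sub>R 2 + (r /\<^sub>R n - p /\<^sub>R 2) extreme_point_of cut m n"
      using ex3 by simp
  next
    show "\<forall>x\<in>cut m n. 0 \<le> ?N \<bullet> (x - (v + p /\<^sub>R 2)) \<and> 0 \<le> m *\<^sub>R B \<bullet> (x - (v + p /\<^sub>R 2)) \<and>
        0 \<le> n *\<^sub>R C \<bullet> (x - (v + p /\<^sub>R 2))"
    proof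
      fix x assume x: "x \<in> cut m n"
      then have "1 \<le> ?N \<bullet> (x - v)" "0 \<le> B \<bullet> (x - v)" "0 \<le> C \<bullet> (x - v)"
        using cone by (auto simp: N)
      moreover have "?N \<bullet> (x - (v + p /\<^sub>R 2)) = ?N \<bullet> (x - v) - 1" "B \<bullet> (x - (v + p /\<^sub>R 2)) = B \<bullet> (x - v)"
        "C \<bullet> (x - (v + p /\<^sub>R 2)) = C \<bullet> (x - v)"
        by (simp_all add: inner_diff_right inner_add_left inner_add_right dual)
      ultimately show "0 \<le> ?N \<bullet> (x - (v + p /\<^sub>R 2)) \<and> 0 \<le> m *\<^sub>R B \<bullet> (x - (v + p /\<^sub>R 2)) \<and>
          0 \<le> n *\<^sub>R C \<bullet> (x - (v + p /\<^sub>R 2))"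
        using mn by simp
    qed
  qed (use mn in \<open>simp_all add: inner_add_left inner_diff_right dual\<close>)
qed

lemma cut_face_eq_hull:
  assumes mn: "1 \<le> m" "1 \<le> n"
  shows "cut_face m n = convex hull {v + p /\<^sub>R 2, v + q /\<^sub>R m, v + r /\<^sub>R n}" (is "_ = convex hull ?S")
proof
  interpret cut: corner "p /\<^sub>R 2" "q /\<^sub>R m - p /\<^sub>R 2" "r /\<^sub>R n - p /\<^sub>R 2" "2 *\<^sub>R A + m *\<^sub>R B + n *\<^sub>R C"
    "m *\<^sub>R B" "n *\<^sub>R C" "cut m n" "v + p /\<^sub>R 2"
    by (rule corner_cut[OF mn])
  have sub: "?S \<subseteq> cut_face m n"
  proof -
    have "?S \<subseteq> Q"
      using cut.apex cut.neighbours_in by (simp add: cut_def)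
    moreover have "cut_normal m n \<bullet> x = cut_level m n" if "x \<in> ?S" for x
      using that mn cut_normal_inner[of m n x] by (auto simp: inner_add_right dual)
    ultimately show ?thesis by (auto simp: cut_face_def)
  qed
  moreover have "convex (cut_face m n)"
    unfolding cut_face_def by (intro convex_Int convex convex_hyperplane)
  ultimately show "convex hull ?S \<subseteq> cut_face m n"
    by (rule hull_minimal)
  show "cut_face m n \<subseteq> convex hull ?S"
  proof
    fix x assume x: "x \<in> cut_face m n"
    \<comment> \<open>On the cutting plane these are the barycentric coordinates with respect to the
      triangle.\<close>
    let ?a = "2 * (A \<bullet> (x - v))" and ?b = "m * (B \<bullet> (x - v))" and ?c = "n * (C \<bullet> (x - v))"
    have s: "?a + ?b + ?c = 1"
      using x cut_normal_inner[of m n x] by (simp add: cut_face_def)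
    have "0 \<le> ?a \<and> 0 \<le> ?b \<and> 0 \<le> ?c"
      using x cone mn by (auto simp: cut_face_def)
    moreover have "x = ?a *\<^sub>R (v + p /\<^sub>R 2) + ?b *\<^sub>R (v + q /\<^sub>R m) + ?c *\<^sub>R (v + r /\<^sub>R n)"
    proof -
      have "?a *\<^sub>R (v + p /\<^sub>R 2) + ?b *\<^sub>R (v + q /\<^sub>R m) + ?c *\<^sub>R (v + r /\<^sub>R n) =
          (?a + ?b + ?c) *\<^sub>R v + (A \<bullet> (x - v)) *\<^sub>R p + (B \<bullet> (x - v)) *\<^sub>R q + (C \<bullet> (x - v)) *\<^sub>R r"
        using mn by (simp add: scaleR_add_right scaleR_add_left add_ac mult.assoc[symmetric] mult.commute[of _ "inverse _"])
      then show ?thesis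
        using coordinates[of x v] s by simp
    qed
    ultimately show "x \<in> convex hull ?S"
      unfolding convex_hull_3 using s by blast
  qed
qed

end

context corner
begin

text \<open>The three points are among the four independent points of the corner left by the
  cut.\<close>

lemma cut_face_simplex:
  assumes mn: "1 \<le> m" "1 \<le> n"
  shows "2 simplex cut_face m n"
proof -
  interpret cut: corner "p /\<^sub>R 2" "q /\<^sub>R m - p /\<^sub>R 2" "r /\<^sub>R n - p /\<^sub>R 2" "2 *\<^sub>R A + m *\<^sub>R B + n *\<^sub>R C"
    "m *\<^sub>R B" "n *\<^sub>R C" "cut m n" "v + p /\<^sub>R 2"
    by (rule corner_cut[OF mn])
  let ?S = "{v + p /\<^sub>R 2, v + q /\<^sub>R m, v + r /\<^sub>R n}"
  have "{v + p /\<^sub>R 2, v + p, v + q /\<^sub>R m, v + r /\<^sub>R n} = insert (v + p) ?S"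
    by blast
  then have S: "\<not> affine_dependent (insert (v + p) ?S)" "card (insert (v + p) ?S) = 4"
    using cut.simplex_affine_independent[of "v + p /\<^sub>R 2"]
    by (simp_all add: add.assoc insert_commute flip: scaleR_add_left)
  have "card ?S = 3"
    using S(2) by (auto simp: card_insert_if split: if_splits)
  moreover have "\<not> affine_dependent ?S"
    using S(1) affine_independent_subset by blast
  ultimately show ?thesis
    unfolding cut_face_eq_hull[OF mn] by (intro simplex_convex_hull) simp
qed

lemma apex_extreme: "v extreme_point_of Q"
proof (rule extreme_point_of_Int_supporting_hyperplane_ge)
  show "Q \<inter> {x. (A + B + C) \<bullet> x = (A + B + C) \<bullet> v} = {v}"
  proof (intro equalityI subsetI)
    fix x assume x: "x \<in> Q \<inter> {x. (A + B + C) \<bullet> x = (A + B + C) \<bullet> v}"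
    then have "A \<bullet> (x - v) + B \<bullet> (x - v) + C \<bullet> (x - v) = 0"
      by (simp add: inner_add_left inner_diff_right)
    moreover have "0 \<le> A \<bullet> (x - v)" "0 \<le> B \<bullet> (x - v)" "0 \<le> C \<bullet> (x - v)"
      using x cone by auto
    ultimately have "A \<bullet> (x - v) = 0" "B \<bullet> (x - v) = 0" "C \<bullet> (x - v) = 0"
      by linarith+
    then have "x = v"
      by (intro coordinates_eqI[of x v]) simp_all
    then show "x \<in> {v}" by simp
  qed (use apex in auto)
  show "(A + B + C) \<bullet> v \<le> (A + B + C) \<bullet> x" if "x \<in> Q" for x
  proof -
    have "0 \<le> A \<bullet> (x - v)" "0 \<le> B \<bullet> (x - v)" "0 \<le> C \<bullet> (x - v)"
      using that cone by auto
    then show ?thesis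
      by (simp add: inner_add_left inner_diff_right)
  qed
qed

text \<open>As \<open>m\<close> and \<open>n\<close> are at least 1, points of the cap have
  coordinate sum at most 1 and lie in the simplex spanned by \<open>v\<close> and its neighbours. A
  vertex of \<open>Q\<close> in there is a vertex of that simplex.\<close>

lemma cap_vertices:
  assumes mn: "1 \<le> m" "1 \<le> n"
  shows "{x. x extreme_point_of Q \<and> cut_level m n \<le> cut_normal m n \<bullet> x} =
    {v} \<union> (if m = 1 then {v + q} else {}) \<union> (if n = 1 then {v + r} else {})"
    (is "?L = ?R")
proof (intro equalityI subsetI)
  fix x assume "x \<in> ?L"
  then have x: "x extreme_point_of Q" "x \<in> Q"
    and le: "2 * (A \<bullet> (x - v)) + m * (B \<bullet> (x - v)) + n * (C \<bullet> (x - v)) \<le> 1"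
    using cut_normal_inner[of m n x] by (auto simp: extreme_point_of_def)
  have pos: "0 \<le> A \<bullet> (x - v)" "0 \<le> B \<bullet> (x - v)" "0 \<le> C \<bullet> (x - v)"
    using x cone by auto
  have "B \<bullet> (x - v) \<le> m * (B \<bullet> (x - v))" "C \<bullet> (x - v) \<le> n * (C \<bullet> (x - v))"
    using mult_right_mono[OF mn(1) pos(2)] mult_right_mono[OF mn(2) pos(3)] by simp_all
  then have "x \<in> convex hull {v, v + p, v + q, v + r}"
    using le pos by (intro mem_simplex) linarith+
  then have "x extreme_point_of convex hull {v, v + p, v + q, v + r}"
    using x(1) simplex_subset unfolding extreme_point_of_def by blast
  then have "x \<in> {v, v + p, v + q, v + r}"
    by (rule extreme_point_of_convex_hull)
  then show "x \<in> ?R"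
    using le mn by (auto simp: dual)
next
  fix x assume "x \<in> ?R"
  then have "x = v \<or> m = 1 \<and> x = v + q \<or> n = 1 \<and> x = v + r"
    by (auto split: if_splits)
  then show "x \<in> ?L"
    using apex_extreme neighbours cut_normal_inner[of m n x] by (auto simp: dual)
qed

text \<open>The triangle brings three vertices, while \<open>v\<close> and the neighbours on the
  plane drop out of the old count. A facet could vanish only if all its vertices were in the cap,
  which has at most three: it would be the triangle on \<open>v\<close>, \<open>v + q\<close>,
  \<open>v + r\<close>. The point \<open>z\<close> in \<open>nonface\<close> shows that this
  triangle is not a whole facet.\<close>

lemma cut_face_numbers:
  assumes mn: "1 \<le> m" "1 \<le> n"
    and nonface: "m \<noteq> 1 \<or> n \<noteq> 1 \<or> (\<exists>z\<in>Q. A \<bullet> (z - v) = 0 \<and> 0 < B \<bullet> (z - v) \<and> 0 < C \<bullet> (z - v) \<and>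
      1 < B \<bullet> (z - v) + C \<bullet> (z - v))"
  shows "face_number (cut m n) 0 + 1 + of_bool (m = 1) + of_bool (n = 1) = face_number Q 0 + 3"
    and "face_number (cut m n) 2 = face_number Q 2 + 1"
proof -
  let ?a = "cut_normal m n" and ?b = "cut_level m n"
  let ?W = "{x. x extreme_point_of Q \<and> ?b \<le> ?a \<bullet> x}"
  have halfspace: "face_number (cut m n) k =
      card {F. F face_of Q \<and> aff_dim F = int k \<and> (\<exists>x\<in>F. ?a \<bullet> x < ?b)} + face_number (cut_face m n) k" for k
    unfolding face_number_def cut_def cut_face_def by (rule card_faces_halfspace_section[OF polytope])
  obtain S where S: "\<not> affine_dependent S" "int (card S) = 3" "cut_face m n = convex hull S"
    using cut_face_simplex[OF mn] by (auto simp: simplex_def)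
  have "face_number (cut_face m n) 0 = 3"
    using S by (simp add: face_number_0 extreme_point_of_convex_hull_affine_independent)
  moreover have "{F. F face_of Q \<and> aff_dim F = int 0 \<and> (\<exists>x\<in>F. ?a \<bullet> x < ?b)} =
      (\<lambda>x. {x}) ` {x. x extreme_point_of Q \<and> ?a \<bullet> x < ?b}"
    by (auto simp: aff_dim_eq_0 face_of_singleton[symmetric])
  then have "card {F. F face_of Q \<and> aff_dim F = int 0 \<and> (\<exists>x\<in>F. ?a \<bullet> x < ?b)} =
      card {x. x extreme_point_of Q \<and> ?a \<bullet> x < ?b}"
    by (simp add: card_image)
  moreover have "card {x. x extreme_point_of Q \<and> ?a \<bullet> x < ?b} + card ?W = face_number Q 0"
  proof -
    have "{x. x extreme_point_of Q} = {x. x extreme_point_of Q \<and> ?a \<bullet> x < ?b} \<union> ?W"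
      by auto
    moreover have "{x. x extreme_point_of Q \<and> ?a \<bullet> x < ?b} \<inter> ?W = {}"
      by auto
    moreover have "finite {x. x extreme_point_of Q \<and> ?a \<bullet> x < ?b}" "finite ?W"
      using finite_extreme_points[OF polytope] by (auto intro: rev_finite_subset)
    ultimately show ?thesis
      unfolding face_number_0 by (simp only: card_Un_disjoint)
  qed
  moreover have "card ?W = 1 + of_bool (m = 1) + of_bool (n = 1)"
  proof -
    have "v \<noteq> v + q" "v \<noteq> v + r" "v + q \<noteq> v + r"
      using dual by auto
    then show ?thesis
      unfolding cap_vertices[OF mn] by simp
  qed
  ultimately show "face_number (cut m n) 0 + 1 + of_bool (m = 1) + of_bool (n = 1) = face_number Q 0 + 3"
    using halfspace[of 0] by linarith
  have "face_number (cut_face m n) 2 = 1"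
    using aff_dim_simplex[OF cut_face_simplex[OF mn]] convex_simplex[OF cut_face_simplex[OF mn]]
    by (intro face_number_top) auto
  moreover have "\<exists>x\<in>F. ?a \<bullet> x < ?b" if F: "F face_of Q" "aff_dim F = 2" for F
  proof (rule ccontr)
    assume "\<not> ?thesis"
    then have low: "\<forall>x\<in>F. ?b \<le> ?a \<bullet> x" by auto
    have "polytope F"
      using F(1) polytope face_of_polytope_polytope by blast
    have sub: "{x. x extreme_point_of F} \<subseteq> ?W"
      using low extreme_point_of_face[OF F(1)] by blast
    have "finite ?W"
      using finite_extreme_points[OF polytope] by (auto intro: rev_finite_subset)
    have "3 \<le> card {x. x extreme_point_of F}"
      using aff_dim_less_face_number[OF \<open>polytope F\<close>] F(2) by (simp add: face_number_0)
    moreover have "card {x. x extreme_point_of F} \<le> card ?W"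
      by (rule card_mono[OF \<open>finite ?W\<close> sub])
    moreover have "card ?W = 1 + of_bool (m = 1) + of_bool (n = 1)"
      by fact
    ultimately have "m = 1" "n = 1" "card ?W \<le> card {x. x extreme_point_of F}"
      by (auto split: if_splits simp: of_bool_def)
    then have "{x. x extreme_point_of F} = ?W"
      using card_seteq[OF \<open>finite ?W\<close> sub] by blast
    then have "v extreme_point_of F" "v + q extreme_point_of F" "v + r extreme_point_of F"
      using cap_vertices[OF mn] \<open>m = 1\<close> \<open>n = 1\<close> by auto
    then have vF: "v \<in> F" "v + q \<in> F" "v + r \<in> F"
      by (auto simp: extreme_point_of_def)
    obtain z where z: "z \<in> Q" "A \<bullet> (z - v) = 0" "0 < B \<bullet> (z - v)" "0 < C \<bullet> (z - v)"
      "1 < B \<bullet> (z - v) + C \<bullet> (z - v)"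
      using nonface \<open>m = 1\<close> \<open>n = 1\<close> by blast
    \<comment> \<open>\<open>y\<close> is the point where the segment from \<open>v\<close> to
      \<open>z\<close> meets the segment from \<open>v + q\<close> to \<open>v + r\<close>. It lies
      in \<open>F\<close> and strictly inside the first segment, so the face \<open>F\<close> must
      contain \<open>z\<close>, which is below the plane.\<close>
    let ?s = "B \<bullet> (z - v) + C \<bullet> (z - v)"
    define y where "y = v + (1 / ?s) *\<^sub>R (z - v)"
    have "y \<in> open_segment v z"
    proof -
      have "z \<noteq> v" using z(3) by auto
      then show ?thesis
        unfolding in_segment y_def using z(5)
        by (intro conjI exI[of _ "1 / ?s"]) (auto simp: algebra_simps)
    qed
    moreover have "y \<in> F"
    proof -
      define b c where "b = B \<bullet> (z - v) / ?s" and "c = C \<bullet> (z - v) / ?s"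
      have bc: "0 \<le> b" "0 \<le> c" "b + c = 1"
        using z by (auto simp: b_def c_def simp flip: add_divide_distrib)
      have "z - v = (B \<bullet> (z - v)) *\<^sub>R q + (C \<bullet> (z - v)) *\<^sub>R r"
        using span[of "z - v"] z(2) by simp
      then have "(1 / ?s) *\<^sub>R (z - v) = (1 / ?s) *\<^sub>R ((B \<bullet> (z - v)) *\<^sub>R q + (C \<bullet> (z - v)) *\<^sub>R r)"
        by (rule arg_cong)
      also have "\<dots> = b *\<^sub>R q + c *\<^sub>R r"
        by (simp add: b_def c_def scaleR_add_right)
      finally have "y = (b + c) *\<^sub>R v + (b *\<^sub>R q + c *\<^sub>R r)"
        by (simp only: bc(3) y_def scaleR_one)
      then have "y = b *\<^sub>R (v + q) + c *\<^sub>R (v + r)"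
        by (simp add: algebra_simps)
      then show ?thesis
        using convexD[OF face_of_imp_convex[OF F(1)] vF(2,3) bc] by simp
    qed
    ultimately have "z \<in> F"
      using face_ofD[OF F(1)] apex z(1) by blast
    then have "?b \<le> ?a \<bullet> z" using low by blast
    then show False
      using cut_normal_inner[of m n z] z \<open>m = 1\<close> \<open>n = 1\<close> by simp
  qed
  then have "{F. F face_of Q \<and> aff_dim F = int 2 \<and> (\<exists>x\<in>F. ?a \<bullet> x < ?b)} = {F. F face_of Q \<and> aff_dim F = int 2}"
    by auto
  ultimately show "face_number (cut m n) 2 = face_number Q 2 + 1"
    using halfspace[of 2] by (simp add: face_number_def)
qed

end

lemma (in frame) corner_simplex: "corner p q r A B C (convex hull {v, v + p, v + q, v + r}) v"
proof unfold_locales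
  let ?S = "{v, v + p, v + q, v + r}"
  show "polytope3 (convex hull ?S)"
    using affine_hull_simplex[of v] aff_dim_affine_hull[of ?S]
    by (simp add: polytope3_def polytope_convex_hull aff_dim_convex_hull)
  show "v \<in> convex hull ?S"
    by (simp add: hull_inc)
  show "\<forall>x\<in>convex hull ?S. 0 \<le> A \<bullet> (x - v) \<and> 0 \<le> B \<bullet> (x - v) \<and> 0 \<le> C \<bullet> (x - v)"
  proof -
    have "convex hull ?S \<subseteq> {x. A \<bullet> v \<le> A \<bullet> x} \<inter> {x. B \<bullet> v \<le> B \<bullet> x} \<inter> {x. C \<bullet> v \<le> C \<bullet> x}"
      by (intro hull_minimal convex_Int convex_halfspace_ge) (simp add: inner_add_right dual)
    then show ?thesis
      by (auto simp: inner_diff_right)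
  qed
  show "v + p extreme_point_of convex hull ?S" "v + q extreme_point_of convex hull ?S"
    "v + r extreme_point_of convex hull ?S"
    by (simp_all add: extreme_point_of_convex_hull_affine_independent simplex_affine_independent)
qed

text \<open>The number of facets of a tetrahedron comes from the two general inequalities, which determine it
  once there are four vertices.\<close>

lemma (in frame) face_number_simplex:
  "face_number (convex hull {v, v + p, v + q, v + r}) 0 = 4"
  "face_number (convex hull {v, v + p, v + q, v + r}) 2 = 4"
proof -
  let ?T = "convex hull {v, v + p, v + q, v + r}"
  show "face_number ?T 0 = 4"
    using simplex_affine_independent[of v]
    by (simp add: face_number_0 extreme_point_of_convex_hull_affine_independent del: insert_iff)
  moreover have "polytope3 ?T"
    by (rule corner.polytope3[OF corner_simplex])
  ultimately show "face_number ?T 2 = 4"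
    using Euler_polytope3[of ?T] face_number_inequalities[of ?T] by linarith
qed

section \<open>Realisation of face numbers near a vertex\<close>

text \<open>The base \<open>h \<bullet> x \<le> t\<close> of a polytope is not affected by cuts close to a vertex above it.\<close>

definition apex_above :: "real^3 \<Rightarrow> real \<Rightarrow> real^3 \<Rightarrow> real^3 \<Rightarrow> real^3 \<Rightarrow> real^3 \<Rightarrow> bool" where
  "apex_above h t v p q r \<longleftrightarrow> t < h \<bullet> v \<and> t \<le> h \<bullet> (v + p) \<and> t \<le> h \<bullet> (v + q) \<and> t \<le> h \<bullet> (v + r)"

definition peaked :: "real^3 \<Rightarrow> real \<Rightarrow> (real^3) set \<Rightarrow> bool" where
  "peaked h t Q \<longleftrightarrow> (\<exists>p q r A B C v. corner p q r A B C Q v \<and> apex_above h t v p q r)"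

text \<open>The new points lie on the segments from \<open>v\<close> to its neighbours, and
  \<open>h\<close> is at least \<open>t\<close> at both ends.\<close>

lemma apex_above_cut:
  assumes "apex_above h t v p q r" "1 \<le> m" "1 \<le> n"
  shows "apex_above h t (v + p /\<^sub>R 2) (p /\<^sub>R 2) (q /\<^sub>R m - p /\<^sub>R 2) (r /\<^sub>R n - p /\<^sub>R 2)"
proof -
  have "t \<le> h \<bullet> (v + y /\<^sub>R k)" if "1 \<le> k" "t \<le> h \<bullet> (v + y)" for y k
  proof -
    have "0 \<le> (k - 1) * (h \<bullet> v - t)"
      using that(1) assms(1) by (simp add: apex_above_def)
    then have "t * k \<le> k * (h \<bullet> v) + h \<bullet> y"
      using that(2) by (simp add: inner_add_right algebra_simps)
    then show ?thesis
      using that(1) by (simp add: inner_add_right field_simps)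
  qed
  with assms show ?thesis
    by (simp add: apex_above_def inner_add_right)
qed

context corner
begin

text \<open>Per unit of coordinate sum, \<open>h\<close> falls by at most
  \<open>h \<bullet> v - t\<close>, so level \<open>t\<close> is reached only where the sum is at
  least 1. The cut removes only points with sum below 1.\<close>

lemma below_subset_cut:
  assumes "apex_above h t v p q r" "1 \<le> m" "1 \<le> n"
  shows "Q \<inter> {x. h \<bullet> x \<le> t} \<subseteq> cut m n"
proof
  fix x assume "x \<in> Q \<inter> {x. h \<bullet> x \<le> t}"
  then have x: "x \<in> Q" "h \<bullet> x \<le> t" by auto
  let ?a = "A \<bullet> (x - v)" and ?b = "B \<bullet> (x - v)" and ?c = "C \<bullet> (x - v)"
  have pos: "0 \<le> ?a" "0 \<le> ?b" "0 \<le> ?c"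
    using x(1) cone by auto
  have t: "t - h \<bullet> v \<le> h \<bullet> p" "t - h \<bullet> v \<le> h \<bullet> q" "t - h \<bullet> v \<le> h \<bullet> r" "t < h \<bullet> v"
    using assms(1) by (auto simp: apex_above_def inner_add_right)
  have "h \<bullet> (x - v) = ?a * (h \<bullet> p) + ?b * (h \<bullet> q) + ?c * (h \<bullet> r)"
    by (subst span[of "x - v"]) (simp only: inner_add_right inner_scaleR_right)
  then have "(t - h \<bullet> v) * (?a + ?b + ?c) \<le> h \<bullet> x - h \<bullet> v"
    using mult_left_mono[OF t(1) pos(1)] mult_left_mono[OF t(2) pos(2)] mult_left_mono[OF t(3) pos(3)]
    by (simp add: inner_diff_right algebra_simps)
  also have "\<dots> \<le> (t - h \<bullet> v) * 1"
    using x(2) by simp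
  finally have "1 \<le> ?a + ?b + ?c"
    using t(4) by (simp add: mult_le_cancel_left)
  moreover have "?b \<le> m * ?b" "?c \<le> n * ?c"
    using mult_right_mono[OF assms(2) pos(2)] mult_right_mono[OF assms(3) pos(3)] by simp_all
  ultimately have "1 \<le> 2 * ?a + m * ?b + n * ?c"
    using pos(1) by linarith
  then show "x \<in> cut m n"
    using x(1) cut_normal_inner[of m n x] by (simp add: cut_def)
qed

lemma peaked_cut: "apex_above h t v p q r \<Longrightarrow> 1 \<le> m \<Longrightarrow> 1 \<le> n \<Longrightarrow> peaked h t (cut m n)"
  unfolding peaked_def using corner_cut apex_above_cut by blast

lemma cut_subset: "cut m n \<subseteq> Q"
  by (simp add: cut_def)

end

text \<open>The two inclusions together say that \<open>Q\<close> and \<open>Q'\<close> agree up to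
  level \<open>t\<close>; \<open>i\<close> and \<open>j\<close> are the gains in vertices and
  facets.\<close>

definition refines :: "real^3 \<Rightarrow> real \<Rightarrow> (real^3) set \<Rightarrow> nat \<Rightarrow> nat \<Rightarrow> (real^3) set \<Rightarrow> bool" where
  "refines h t Q i j Q' \<longleftrightarrow> peaked h t Q' \<and> Q' \<subseteq> Q \<and> Q \<inter> {x. h \<bullet> x \<le> t} \<subseteq> Q' \<and>
    face_number Q' 0 = face_number Q 0 + i \<and> face_number Q' 2 = face_number Q 2 + j"

lemma refines_trans:
  "refines h t Q i j Q' \<Longrightarrow> refines h t Q' k l Q'' \<Longrightarrow> refines h t Q (i + k) (j + l) Q''"
  unfolding refines_def by auto

lemma refines_truncate:
  assumes "peaked h t Q"
  shows "\<exists>Q'. refines h t Q 2 1 Q'"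
proof -
  obtain p q r A B C v where Q: "corner p q r A B C Q v" and ab: "apex_above h t v p q r"
    using assms by (auto simp: peaked_def)
  interpret corner p q r A B C Q v by (rule Q)
  have "peaked h t (cut 2 2)"
    by (rule peaked_cut[OF ab]) simp_all
  then have "refines h t Q 2 1 (cut 2 2)"
    using below_subset_cut[OF ab, of 2 2] cut_subset cut_face_numbers[of 2 2] by (simp add: refines_def)
  then show ?thesis ..
qed

text \<open>A plane through the neighbour \<open>v + r\<close> raises both numbers by one.  The new corner at \<open>v + q / 2\<close> has the
  edges to \<open>v + p / 2\<close> and \<open>v + q\<close> in the quadrilateral cut out of the facet \<open>v, v + p, v + q\<close>, so its plane through
  these two neighbours creates a facet and no vertex.\<close>

lemma refines_pull:
  assumes "peaked h t Q"
  shows "\<exists>Q'. refines h t Q 1 1 Q'" "\<exists>Q'. refines h t Q 1 2 Q'"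
proof -
  \<comment> \<open>The first two directions are exchanged, so that the new corner arises at
    \<open>v + q / 2\<close>.\<close>
  obtain p q r A B C v where Q: "corner q p r B A C Q v" and ab: "apex_above h t v q p r"
    using assms by (auto simp: peaked_def)
  interpret corner q p r B A C Q v by (rule Q)
  let ?Q = "cut 2 1"
  let ?p = "q /\<^sub>R 2" and ?q = "p /\<^sub>R 2 - q /\<^sub>R 2" and ?r = "r /\<^sub>R 1 - q /\<^sub>R 2"
  let ?A = "2 *\<^sub>R B + 2 *\<^sub>R A + 1 *\<^sub>R C" and ?B = "2 *\<^sub>R A" and ?C = "1 *\<^sub>R C" and ?v = "v + q /\<^sub>R 2"
  have c1: "corner ?p ?q ?r ?A ?B ?C ?Q ?v"
    by (rule corner_cut) simp_all
  have ab1: "apex_above h t ?v ?p ?q ?r"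
    by (rule apex_above_cut[OF ab]) simp_all
  have "peaked h t ?Q"
    unfolding peaked_def using c1 ab1 by blast
  then have ref1: "refines h t Q 1 1 ?Q"
    using below_subset_cut[OF ab, of 2 1] cut_subset cut_face_numbers[of 2 1] by (simp add: refines_def)
  then show "\<exists>Q'. refines h t Q 1 1 Q'" ..
  interpret c1: corner ?p ?q ?r ?A ?B ?C ?Q ?v by (rule c1)
  interpret c2: corner ?r ?q ?p ?C ?B ?A ?Q ?v by (rule c1.swap13)
  have ab2: "apex_above h t ?v ?r ?q ?p"
    using ab1 by (auto simp: apex_above_def)
  let ?Q2 = "c2.cut 1 1"
  \<comment> \<open>\<open>v + p\<close> is the witness for \<open>nonface\<close>: in the plane of
    the quadrilateral it has coordinates 2 and 1, beyond the line through the two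
    neighbours.\<close>
  have "v + p \<in> ?Q"
    using neighbours_in(2) cut_normal_inner[of 2 1 "v + p"] by (simp add: cut_def dual)
  moreover have "1 *\<^sub>R C \<bullet> (v + p - (v + q /\<^sub>R 2)) = 0" "2 *\<^sub>R A \<bullet> (v + p - (v + q /\<^sub>R 2)) = 2"
    "?A \<bullet> (v + p - (v + q /\<^sub>R 2)) = 1"
    by (simp_all add: inner_add_left inner_diff_right dual)
  ultimately have "\<exists>z\<in>?Q. ?C \<bullet> (z - ?v) = 0 \<and> 0 < ?B \<bullet> (z - ?v) \<and> 0 < ?A \<bullet> (z - ?v) \<and>
      1 < ?B \<bullet> (z - ?v) + ?A \<bullet> (z - ?v)"
    by (intro bexI[of _ "v + p"]) auto
  then have "face_number ?Q2 0 = face_number ?Q 0 + 0" "face_number ?Q2 2 = face_number ?Q 2 + 1"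
    using c2.cut_face_numbers[of 1 1] by simp_all
  moreover have "peaked h t ?Q2"
    by (rule c2.peaked_cut[OF ab2]) simp_all
  ultimately have "refines h t ?Q 0 1 ?Q2"
    using c2.below_subset_cut[OF ab2, of 1 1] c2.cut_subset by (simp add: refines_def)
  then have "refines h t Q (1 + 0) (1 + 1) ?Q2"
    by (rule refines_trans[OF ref1])
  then have "refines h t Q 1 2 ?Q2"
    by (simp only: one_add_one add_0_right)
  then show "\<exists>Q'. refines h t Q 1 2 Q'" ..
qed

lemma refines_funpow:
  assumes step: "\<And>Q. peaked h t Q \<Longrightarrow> \<exists>Q'. refines h t Q i j Q'" and Q: "peaked h t Q"
  shows "\<exists>Q'. refines h t Q (k * i) (k * j) Q'"
proof (induction k)
  case 0
  have "refines h t Q (0 * i) (0 * j) Q"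
    using Q by (simp add: refines_def)
  then show ?case ..
next
  case (Suc k)
  then obtain Q' where Q': "refines h t Q (k * i) (k * j) Q'" ..
  then have "peaked h t Q'" by (simp add: refines_def)
  then obtain Q'' where "refines h t Q' i j Q''" using step by blast
  then have "refines h t Q (k * i + i) (k * j + j) Q''"
    by (rule refines_trans[OF Q'])
  then show ?case
    by (auto simp: add.commute)
qed

lemma f_vector_eqI:
  assumes "polytope3 P" "polytope3 Q" "face_number P 0 = face_number Q 0" "face_number P 2 = face_number Q 2"
  shows "f_vector P = f_vector Q"
  using assms Euler_polytope3[of P] Euler_polytope3[of Q] by (simp add: f_vector_def)

lemma peaked_polytope3: "peaked h t Q \<Longrightarrow> polytope3 Q"
  using corner.polytope3 by (auto simp: peaked_def)

lemma f_vector_realisation: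
  assumes T: "peaked h t T" "face_number T 0 = 4" "face_number T 2 = 4" and P: "polytope3 P"
  shows "\<exists>Q. peaked h t Q \<and> Q \<subseteq> T \<and> T \<inter> {x. h \<bullet> x \<le> t} \<subseteq> Q \<and> f_vector Q = f_vector P"
proof -
  let ?m = "face_number P 0" and ?n = "face_number P 2"
  have bounds: "?m + 4 \<le> 2 * ?n" "?n + 4 \<le> 2 * ?m"
    using Euler_polytope3[OF P] face_number_inequalities[OF P] by linarith+
  \<comment> \<open>For n \<le> m the gain (m - 4, n - 4) is (2 n - m - 4) times (1, 1) plus (m - n)
    times (2, 1); otherwise it is (2 m - n - 4) times (1, 1) plus (n - m) times (1, 2).
    \<open>bounds\<close> makes these natural subtractions exact.\<close>
  have "\<exists>Q. refines h t T (?m - 4) (?n - 4) Q"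
  proof (cases "?n \<le> ?m")
    case True
    obtain Q1 where Q1: "refines h t T ((2 * ?n - ?m - 4) * 1) ((2 * ?n - ?m - 4) * 1) Q1"
      using refines_funpow[OF refines_pull(1) T(1)] by blast
    then have "peaked h t Q1" by (simp add: refines_def)
    then obtain Q where "refines h t Q1 ((?m - ?n) * 2) ((?m - ?n) * 1) Q"
      using refines_funpow[OF refines_truncate] by blast
    then have "refines h t T ((2 * ?n - ?m - 4) * 1 + (?m - ?n) * 2) ((2 * ?n - ?m - 4) * 1 + (?m - ?n) * 1) Q"
      by (rule refines_trans[OF Q1])
    moreover have "(2 * ?n - ?m - 4) * 1 + (?m - ?n) * 2 = ?m - 4" "(2 * ?n - ?m - 4) * 1 + (?m - ?n) * 1 = ?n - 4"
      using True bounds by linarith+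
    ultimately show ?thesis by metis
  next
    case False
    obtain Q1 where Q1: "refines h t T ((2 * ?m - ?n - 4) * 1) ((2 * ?m - ?n - 4) * 1) Q1"
      using refines_funpow[OF refines_pull(1) T(1)] by blast
    then have "peaked h t Q1" by (simp add: refines_def)
    then obtain Q where "refines h t Q1 ((?n - ?m) * 1) ((?n - ?m) * 2) Q"
      using refines_funpow[OF refines_pull(2)] by blast
    then have "refines h t T ((2 * ?m - ?n - 4) * 1 + (?n - ?m) * 1) ((2 * ?m - ?n - 4) * 1 + (?n - ?m) * 2) Q"
      by (rule refines_trans[OF Q1])
    moreover have "(2 * ?m - ?n - 4) * 1 + (?n - ?m) * 1 = ?m - 4" "(2 * ?m - ?n - 4) * 1 + (?n - ?m) * 2 = ?n - 4"
      using False bounds by linarith+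
    ultimately show ?thesis by metis
  qed
  then obtain Q where Q: "refines h t T (?m - 4) (?n - 4) Q" ..
  have "4 \<le> ?m" "4 \<le> ?n"
    using bounds by linarith+
  then have "f_vector Q = f_vector P"
    using Q T P peaked_polytope3 by (intro f_vector_eqI) (auto simp: refines_def)
  then show ?thesis
    using Q by (auto simp: refines_def)
qed

section \<open>Gluing along a section\<close>

text \<open>\<open>Q\<close> replaces the part of \<open>P\<close> above the plane \<open>a \<bullet> x = b\<close>.\<close>

locale gluing =
  fixes P Q :: "(real^3) set" and a :: "real^3" and b :: real
  assumes P: "polytope3 P" and Q: "polytope3 Q"
    and Q_subset: "Q \<subseteq> P" and Q_ge: "\<forall>x\<in>Q. b \<le> a \<bullet> x"
    and section_subset: "P \<inter> {x. a \<bullet> x = b} \<subseteq> Q"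
    and below: "\<exists>x\<in>P. a \<bullet> x < b" and Q_above: "\<exists>x\<in>Q. b < a \<bullet> x"
    and proper: "\<forall>F. F face_of P \<and> F \<noteq> P \<longrightarrow> F \<inter> Q \<subseteq> {x. a \<bullet> x = b}"
begin

definition lower where "lower = P \<inter> {x. a \<bullet> x \<le> b}"

definition G where "G = P \<inter> {x. a \<bullet> x = b}"

definition R where "R = lower \<union> Q"

lemma polytopes: "polytope P" "polytope Q" "polytope lower" "polytope G"
  using P Q polytope_Int_polyhedron[OF _ polyhedron_halfspace_le] polytope_Int_polyhedron[OF _ polyhedron_hyperplane]
  by (auto simp: polytope3_def lower_def G_def)

lemma convex_parts: "convex P" "convex Q" "convex lower" "convex G"
  using polytopes polytope_imp_convex by blast+

lemma R_subset: "R \<subseteq> P"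
  using Q_subset by (auto simp: R_def lower_def)

lemma R_slices:
  "R \<inter> {x. a \<bullet> x \<le> b} = lower" "R \<inter> {x. - a \<bullet> x \<le> - b} = Q" "R \<inter> {x. a \<bullet> x = b} = G"
  using Q_subset Q_ge section_subset by (force simp: R_def lower_def G_def)+

text \<open>Beyond the plane, the segment runs from a point of the section, which lies in
  \<open>Q\<close>, to the endpoint \<open>y\<close> in \<open>Q\<close>.\<close>

lemma segment_in_R:
  assumes x: "x \<in> lower" and y: "y \<in> Q" and z: "z \<in> closed_segment x y"
  shows "z \<in> R"
proof (cases "a \<bullet> z \<le> b")
  case True
  have "x \<in> P" "y \<in> P"
    using x y Q_subset by (auto simp: lower_def)
  then have "z \<in> P"
    using z closed_segment_subset convex_parts(1) by blast
  with True show ?thesis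
    by (simp add: R_def lower_def)
next
  case False
  have "connected (closed_segment x z)"
    by (simp add: convex_connected)
  moreover have "a \<bullet> x \<le> b"
    using x by (simp add: lower_def)
  ultimately obtain g where g: "g \<in> closed_segment x z" "a \<bullet> g = b"
    using connected_ivt_hyperplane[of "closed_segment x z" x z a b] False by auto
  have "x \<in> P" "y \<in> P"
    using x y Q_subset by (auto simp: lower_def)
  then have "z \<in> P"
    using z closed_segment_subset convex_parts(1) by blast
  then have "g \<in> P"
    using g(1) \<open>x \<in> P\<close> closed_segment_subset convex_parts(1) by blast
  then have "g \<in> Q"
    using g(2) section_subset by blast
  have "between (y, g) z"
    using z g(1) between_trans_2[of x y z g] by (simp add: between_mem_segment closed_segment_commute)
  then have "z \<in> closed_segment y g"
    by (simp add: between_mem_segment)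
  then have "z \<in> Q"
    using y \<open>g \<in> Q\<close> closed_segment_subset convex_parts(2) by blast
  then show ?thesis by (simp add: R_def)
qed

lemma convex_R: "convex R"
proof -
  have "closed_segment x y \<subseteq> R" if "x \<in> R" "y \<in> R" for x y
  proof -
    consider "x \<in> lower" "y \<in> lower" | "x \<in> Q" "y \<in> Q" | "x \<in> lower" "y \<in> Q" | "x \<in> Q" "y \<in> lower"
      using \<open>x \<in> R\<close> \<open>y \<in> R\<close> unfolding R_def by blast
    then show ?thesis
    proof cases
      case 1
      then have "closed_segment x y \<subseteq> lower"
        by (rule closed_segment_subset[OF _ _ convex_parts(3)])
      then show ?thesis by (auto simp: R_def)
    next
      case 2
      then have "closed_segment x y \<subseteq> Q"
        by (rule closed_segment_subset[OF _ _ convex_parts(2)])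
      then show ?thesis by (auto simp: R_def)
    next
      case 3
      then show ?thesis using segment_in_R by blast
    next
      case 4
      then show ?thesis using segment_in_R[of y x] by (auto simp: closed_segment_commute)
    qed
  qed
  then show ?thesis
    by (simp add: convex_contains_segment)
qed

lemma polytope_R: "polytope R"
proof -
  obtain S T where S: "finite S" "lower = convex hull S" and T: "finite T" "Q = convex hull T"
    using polytopes by (auto simp: polytope_def)
  have "S \<subseteq> lower" "T \<subseteq> Q"
    using S(2) T(2) hull_subset by metis+
  then have "S \<union> T \<subseteq> R"
    unfolding R_def by blast
  then have "convex hull (S \<union> T) \<subseteq> R"
    using convex_R by (simp add: hull_minimal)
  moreover have "lower \<subseteq> convex hull (S \<union> T)" "Q \<subseteq> convex hull (S \<union> T)"
    using S(2) T(2) hull_mono Un_upper1 Un_upper2 by metis+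
  then have "R \<subseteq> convex hull (S \<union> T)"
    unfolding R_def by blast
  ultimately have "R = convex hull (S \<union> T)" by blast
  with S(1) T(1) show ?thesis
    by (simp add: polytope_convex_hull)
qed

lemma polytope3_R: "polytope3 R"
proof -
  have "aff_dim Q \<le> aff_dim R" "aff_dim R \<le> aff_dim P"
    using R_subset by (intro aff_dim_subset; auto simp: R_def)+
  then show ?thesis
    using P Q polytope_R by (simp add: polytope3_def)
qed

lemma crosses_R: "crosses a b R"
  using below Q_above by (force simp: crosses_def R_def lower_def)

lemma crosses_P: "crosses a b P"
  using crosses_R R_subset by (auto simp: crosses_def)

lemma aff_dim_G: "aff_dim G = 2"
  using aff_dim_crosses_section[OF convex_parts(1) crosses_P] P by (simp add: G_def polytope3_def)

text \<open>\<open>E\<close> is the trace on the plane of a proper face \<open>F\<close> of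
  \<open>P\<close>. By \<open>proper\<close>, \<open>F \<inter> R\<close> has no point above the
  plane, so the plane supports this face of \<open>R\<close> and cuts out \<open>E\<close>.\<close>

lemma face_of_G_imp_face_of_R:
  assumes E: "E face_of G" "E \<noteq> G"
  shows "E face_of R"
proof (cases "E = {}")
  case False
  let ?H = "{x. a \<bullet> x = b}"
  have "E \<in> {E. E face_of P \<inter> ?H \<and> E \<noteq> {}}"
    using E False by (simp add: G_def)
  then obtain F where F: "F face_of P" "E = F \<inter> ?H"
    unfolding faces_hyperplane_section[OF polytopes(1)] by (force simp: Int_absorb2)
  then have "F \<noteq> P"
    using E(2) by (auto simp: G_def)
  then have FQ: "F \<inter> Q \<subseteq> ?H"
    using F(1) proper by blast
  have "F \<inter> R face_of P \<inter> R"
    by (rule face_of_slice[OF F(1) convex_R])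
  then have FR: "F \<inter> R face_of R"
    using R_subset by (simp add: Int_absorb1)
  have "F \<inter> R \<inter> ?H face_of F \<inter> R"
    using FQ face_of_imp_convex[OF FR]
    by (intro face_of_Int_supporting_hyperplane_le) (auto simp: R_def lower_def)
  moreover have "F \<inter> R \<inter> ?H = E"
    using F R_slices(3) face_of_imp_subset[OF F(1)] by (auto simp: G_def)
  ultimately show ?thesis
    using FR face_of_trans by blast
qed simp

lemma G_not_subset_face:
  assumes "F face_of R" "G \<subseteq> F"
  shows "F = R"
proof (rule ccontr)
  assume "F \<noteq> R"
  then have "F \<inter> rel_interior R = {}"
    by (rule face_of_disjoint_rel_interior[OF assms(1)])
  moreover obtain x where "x \<in> rel_interior R" "a \<bullet> x = b"
    using crosses_rel_interior[OF convex_R crosses_R] by blast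
  moreover from this have "x \<in> G"
    using rel_interior_subset R_slices(3) by blast
  ultimately show False
    using assms(2) by blast
qed

text \<open>If \<open>F\<close> crossed, its section would be a proper face of \<open>G\<close>,
  hence a face of \<open>R\<close> containing a relative interior point of \<open>F\<close>. It
  would then contain all of \<open>F\<close>.\<close>

lemma no_proper_face_crosses:
  assumes F: "F face_of R" "F \<noteq> R"
  shows "\<not> crosses a b F"
proof
  assume cr: "crosses a b F"
  have cF: "convex F" using F(1) face_of_imp_convex by blast
  let ?E = "F \<inter> {x. a \<bullet> x = b}"
  obtain x where x: "x \<in> rel_interior F" "a \<bullet> x = b"
    using crosses_rel_interior[OF cF cr] by blast
  have "?E face_of R \<inter> {x. a \<bullet> x = b}"
    by (rule face_of_slice[OF F(1) convex_hyperplane])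
  moreover have "?E \<noteq> G"
    using G_not_subset_face F by blast
  ultimately have "?E face_of R"
    using face_of_G_imp_face_of_R R_slices(3) by simp
  moreover have "x \<in> ?E"
    using x rel_interior_subset by blast
  ultimately have "F \<subseteq> ?E"
    using subset_of_face_of[of ?E R F] face_of_imp_subset[OF F(1)] x(1) by blast
  then show False
    using cr by (force simp: crosses_def)
qed

lemma lower_count:
  "face_number lower k = card {F. F face_of R \<and> aff_dim F = int k \<and> (\<exists>x\<in>F. a \<bullet> x < b)} + face_number G k"
  using card_faces_halfspace_section[OF polytope_R, of a b k] by (simp only: face_number_def R_slices)

lemma upper_count:
  "face_number Q k = card {F. F face_of R \<and> aff_dim F = int k \<and> (\<exists>x\<in>F. b < a \<bullet> x)} + face_number G k"
proof -
  have "R \<inter> {x. - a \<bullet> x = - b} = G"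
    using R_slices(3) by simp
  moreover have "(\<exists>x\<in>F. - a \<bullet> x < - b) \<longleftrightarrow> (\<exists>x\<in>F. b < a \<bullet> x)" for F
    by simp
  ultimately show ?thesis
    using card_faces_halfspace_section[OF polytope_R, of "- a" "- b" k] by (simp only: face_number_def R_slices)
qed

lemma face_number_split:
  assumes "k \<le> 2"
  shows "face_number R k = card {F. F face_of R \<and> aff_dim F = int k \<and> (\<exists>x\<in>F. a \<bullet> x < b)} +
    card {F. F face_of R \<and> aff_dim F = int k \<and> (\<exists>x\<in>F. b < a \<bullet> x)} +
    card {F. F face_of R \<and> aff_dim F = int k \<and> F \<subseteq> {x. a \<bullet> x = b}}"
    (is "_ = card ?A + card ?B + card ?C")
proof -
  have "?A \<inter> ?B = {}"
  proof (rule ccontr)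
    assume "?A \<inter> ?B \<noteq> {}"
    then obtain F where F: "F face_of R" "aff_dim F = int k" "crosses a b F"
      by (auto simp: crosses_def)
    then have "F = R"
      using no_proper_face_crosses by blast
    then show False
      using F(2) polytope3_R assms by (simp add: polytope3_def)
  qed
  moreover have "(?A \<union> ?B) \<inter> ?C = {}"
    by fastforce
  moreover have "{F. F face_of R \<and> aff_dim F = int k} = ?A \<union> ?B \<union> ?C"
    by (auto simp: not_less intro: antisym)
  moreover have "finite ?A" "finite ?B" "finite ?C"
    by (rule finite_faces_Collect[OF polytope_R])+
  ultimately show ?thesis
    unfolding face_number_def by (simp add: card_Un_disjoint)
qed

text \<open>The vertices of \<open>G\<close> are counted in both pieces and survive as the vertices
  of \<open>R\<close> on the plane.\<close>

lemma face_number_0_R: "face_number R 0 + face_number G 0 = face_number lower 0 + face_number Q 0"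
proof -
  have "{F. F face_of R \<and> aff_dim F = int 0 \<and> F \<subseteq> {x. a \<bullet> x = b}} = {F. F face_of G \<and> aff_dim F = int 0}"
  proof (intro equalityI subsetI)
    fix F assume F: "F \<in> {F. F face_of R \<and> aff_dim F = int 0 \<and> F \<subseteq> {x. a \<bullet> x = b}}"
    then have "F \<subseteq> G"
      using R_slices(3) face_of_imp_subset by blast
    moreover have "G \<subseteq> R"
      using R_slices(3) by blast
    ultimately show "F \<in> {F. F face_of G \<and> aff_dim F = int 0}"
      using F face_of_subset by blast
  next
    fix F assume F: "F \<in> {F. F face_of G \<and> aff_dim F = int 0}"
    then have "F \<noteq> G"
      using aff_dim_G by auto
    then show "F \<in> {F. F face_of R \<and> aff_dim F = int 0 \<and> F \<subseteq> {x. a \<bullet> x = b}}"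
      using F face_of_G_imp_face_of_R face_of_imp_subset by (auto simp: G_def)
  qed
  then show ?thesis
    using face_number_split[of 0] lower_count[of 0] upper_count[of 0] by (simp add: face_number_def)
qed

text \<open>\<open>G\<close> is a facet of both pieces but becomes interior to the union, which
  accounts for the 2.\<close>

lemma face_number_2_R: "face_number R 2 + 2 = face_number lower 2 + face_number Q 2"
proof -
  have "F = G" if F: "F face_of R" "aff_dim F = 2" "F \<subseteq> {x. a \<bullet> x = b}" for F
  proof (rule ccontr)
    assume "F \<noteq> G"
    have "F \<subseteq> G"
      using F R_slices(3) face_of_imp_subset by blast
    moreover have "G \<subseteq> R"
      using R_slices(3) by blast
    ultimately have "F face_of G"
      using F face_of_subset by blast
    then have "aff_dim F < aff_dim G"
      using \<open>F \<noteq> G\<close> face_of_aff_dim_lt convex_parts(4) by blast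
    then show False
      using F(2) aff_dim_G by simp
  qed
  moreover have "\<not> G face_of R"
  proof
    assume "G face_of R"
    then have "G = R" using G_not_subset_face by blast
    then show False using aff_dim_G polytope3_R by (simp add: polytope3_def)
  qed
  ultimately have "{F. F face_of R \<and> aff_dim F = int 2 \<and> F \<subseteq> {x. a \<bullet> x = b}} = {}"
    by auto
  moreover have "face_number G 2 = 1"
    using face_number_top[OF convex_parts(4), of 2] aff_dim_G by simp
  ultimately show ?thesis
    using face_number_split[of 2] lower_count[of 2] upper_count[of 2] by (simp only: card.empty)
qed

end

lemma triangle_face_numbers:
  assumes "2 simplex G"
  shows "face_number G 0 = 3" "face_number G 1 = 3"
proof -
  obtain S where S: "\<not> affine_dependent S" "int (card S) = 3" "G = convex hull S"
    using assms by (auto simp: simplex_def)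
  then show G0: "face_number G 0 = 3"
    by (simp add: face_number_0 extreme_point_of_convex_hull_affine_independent)
  show "face_number G 1 = 3"
    using Euler_polygon[OF simplex_imp_polytope[OF assms] aff_dim_simplex[OF assms]] G0 by simp
qed

section \<open>Connected sum at a corner\<close>

context corner
begin

lemma cut_separates:
  "cut_level 2 2 < cut_normal 2 2 \<bullet> v"
  "\<forall>w. w extreme_point_of Q \<and> w \<noteq> v \<longrightarrow> cut_normal 2 2 \<bullet> w < cut_level 2 2"
proof -
  show "cut_level 2 2 < cut_normal 2 2 \<bullet> v"
    by (simp add: cut_level_def)
  have "{x. x extreme_point_of Q \<and> cut_level 2 2 \<le> cut_normal 2 2 \<bullet> x} = {v}"
    using cap_vertices[of 2 2] by simp
  then show "\<forall>w. w extreme_point_of Q \<and> w \<noteq> v \<longrightarrow> cut_normal 2 2 \<bullet> w < cut_level 2 2"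
    by (force simp: not_less)
qed

text \<open>Facets through \<open>v\<close> correspond to edges of its vertex figure, here the
  triangle of the cut.\<close>

lemma simple_vertex: "simple_vertex v Q"
proof -
  have "card {F. F face_of Q \<and> aff_dim F = int 1 + 1 \<and> v \<in> F} = face_number (cut_face 2 2) 1"
    unfolding cut_face_def by (rule face_number_vertex_section[OF polytope apex_extreme cut_separates, symmetric])
  also have "\<dots> = 3"
    by (intro triangle_face_numbers cut_face_simplex) simp_all
  also have "{F. F face_of Q \<and> aff_dim F = int 1 + 1 \<and> v \<in> F} = {F. F facet_of Q \<and> v \<in> F}"
    using aff_dim by (auto simp: facet_of_def)
  finally show ?thesis
    by (simp add: simple_vertex_def apex_extreme)
qed

lemma mem_interior:
  assumes "0 < A \<bullet> (x - v)" "0 < B \<bullet> (x - v)" "0 < C \<bullet> (x - v)"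
    "A \<bullet> (x - v) + B \<bullet> (x - v) + C \<bullet> (x - v) < 1"
  shows "x \<in> interior Q"
proof -
  let ?U = "{x. A \<bullet> v < A \<bullet> x} \<inter> {x. B \<bullet> v < B \<bullet> x} \<inter> {x. C \<bullet> v < C \<bullet> x} \<inter>
    {x. (A + B + C) \<bullet> x < (A + B + C) \<bullet> v + 1}"
  have "?U \<subseteq> convex hull {v, v + p, v + q, v + r}"
    by (auto intro!: mem_simplex simp: inner_diff_right inner_add_left)
  then have "?U \<subseteq> Q"
    using simplex_subset by blast
  moreover have "open ?U"
    by (intro open_Int open_halfspace_lt open_halfspace_gt)
  ultimately have "?U \<subseteq> interior Q"
    by (rule interior_maximal)
  then show ?thesis
    using assms by (auto simp: inner_diff_right inner_add_left)
qed

text \<open>The second summand is built inside the tetrahedron that joins an interior point \<open>w\<close> of the cut-off cap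
  to the cut \<open>G\<close>, so that no projective transformation is needed.\<close>

lemma connected_sum_exists:
  assumes P: "polytope3 P"
  shows "\<exists>P' R. polytope3 P' \<and> f_vector P' = f_vector P \<and> connected_sum Q P' R \<and> polytope3 R \<and>
    f_vector R = f_vector Q \<boxplus>'' f_vector P"
proof -
  define a where "a = cut_normal 2 2"
  define b where "b = cut_level 2 2"
  note inner_a = cut_normal_inner[of 2 2, folded a_def b_def]
  \<comment> \<open>All coordinates of \<open>?w\<close> are 1/8: positive, with sum 3/8 < 1/2.
    Hence \<open>?w\<close> is interior to \<open>Q\<close> and strictly inside the cap removed by
    \<open>cut 2 2\<close>.\<close>
  let ?s = "(p + q + r) /\<^sub>R 8"
  let ?w = "v + ?s"
  let ?p = "p /\<^sub>R 2 - ?s" and ?q = "q /\<^sub>R 2 - ?s" and ?r = "r /\<^sub>R 2 - ?s"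
  let ?A = "4 *\<^sub>R A + 2 *\<^sub>R B + 2 *\<^sub>R C" and ?B = "2 *\<^sub>R A + 4 *\<^sub>R B + 2 *\<^sub>R C" and ?C = "2 *\<^sub>R A + 2 *\<^sub>R B + 4 *\<^sub>R C"
  have "frame ?p ?q ?r ?A ?B ?C"
  proof
    fix x :: "real^3"
    let ?x = "(?A \<bullet> x) *\<^sub>R ?p + (?B \<bullet> x) *\<^sub>R ?q + (?C \<bullet> x) *\<^sub>R ?r"
    show "x = ?x"
      by (rule coordinates_eqI[of x 0])
        (simp_all add: inner_add_left inner_add_right inner_diff_right dual field_simps)
  qed (simp_all add: inner_add_left inner_add_right inner_diff_right dual)
  then interpret T: frame ?p ?q ?r ?A ?B ?C .
  define S where "S = {v + p /\<^sub>R 2, v + q /\<^sub>R 2, v + r /\<^sub>R 2}"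
  define T where "T = convex hull {?w, ?w + ?p, ?w + ?q, ?w + ?r}"
  have T_eq: "T = convex hull (insert ?w S)"
    by (simp add: T_def S_def)
  have T: "corner ?p ?q ?r ?A ?B ?C T ?w" "face_number T 0 = 4" "face_number T 2 = 4"
    unfolding T_def by (rule T.corner_simplex T.face_number_simplex)+
  interpret T: corner ?p ?q ?r ?A ?B ?C T ?w by (rule T(1))
  have aS: "a \<bullet> x = b" if "x \<in> S" for x
    using that inner_a[of x] by (auto simp: S_def dual)
  have aw: "b < a \<bullet> ?w"
  proof -
    have "a \<bullet> ?w - b = 1 / 4"
      unfolding inner_a by (simp add: inner_add_right dual)
    then show ?thesis by linarith
  qed
  \<comment> \<open>The base points lie at level \<open>b\<close> itself, so the realisation inside
    \<open>T\<close> keeps the whole triangle.\<close>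
  have "apex_above a b ?w ?p ?q ?r"
    using aw aS[of "?w + ?p"] aS[of "?w + ?q"] aS[of "?w + ?r"] by (simp add: apex_above_def S_def)
  then have "peaked a b T"
    unfolding peaked_def using T(1) by blast
  then obtain P' where P': "peaked a b P'" "P' \<subseteq> T" "T \<inter> {x. a \<bullet> x \<le> b} \<subseteq> P'" "f_vector P' = f_vector P"
    using f_vector_realisation[OF _ T(2,3) P] by blast
  have w: "?w \<in> interior Q"
    by (rule mem_interior) (simp_all add: inner_add_right dual)
  have G_hull: "cut_face 2 2 = convex hull S"
    by (simp add: cut_face_eq_hull S_def)
  then have "S \<subseteq> Q"
    using hull_subset[of S convex] by (auto simp: cut_face_def)
  then have T_sub: "T \<subseteq> Q"
    unfolding T_eq using w interior_subset convex by (intro hull_minimal) auto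
  have "T \<subseteq> {x. b \<le> a \<bullet> x}"
    unfolding T_eq using aw aS by (intro hull_minimal convex_halfspace_ge) auto
  have G_sub: "Q \<inter> {x. a \<bullet> x = b} \<subseteq> T"
    using G_hull hull_mono[of S "insert ?w S" convex] by (auto simp: T_eq cut_face_def a_def b_def)
  \<comment> \<open>A proper face of \<open>Q\<close> misses the interior point \<open>?w\<close>,
    so the face \<open>F \<inter> T\<close> of \<open>T\<close> has all its vertices in the
    base.\<close>
  have proper: "F \<inter> T \<subseteq> {x. a \<bullet> x = b}" if F: "F face_of Q" "F \<noteq> Q" for F
  proof -
    have "?w \<notin> F"
      using face_of_disjoint_interior[OF F] w by blast
    have "F \<inter> T face_of Q \<inter> T"
      by (rule face_of_slice[OF F(1) T.convex])
    then have face: "F \<inter> T face_of T"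
      using T_sub by (simp add: Int_absorb1)
    then have "F \<inter> T = convex hull {x. x extreme_point_of F \<inter> T}"
      using T.polytope face_of_polytope_polytope polytope_eq_hull_extreme_points by blast
    also have "\<dots> \<subseteq> {x. a \<bullet> x = b}"
    proof (rule hull_minimal)
      show "{x. x extreme_point_of F \<inter> T} \<subseteq> {x. a \<bullet> x = b}"
      proof
        fix x assume "x \<in> {x. x extreme_point_of F \<inter> T}"
        then have "x extreme_point_of T" "x \<in> F"
          using extreme_point_of_face[OF face] by auto
        then have "x \<in> S"
          using extreme_point_of_convex_hull[of x "insert ?w S"] \<open>?w \<notin> F\<close> by (auto simp: T_eq)
        then show "x \<in> {x. a \<bullet> x = b}"
          using aS by simp
      qed
    qed (rule convex_hyperplane)
    finally show ?thesis .
  qed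
  have polyP': "polytope3 P'"
    using P'(1) by (rule peaked_polytope3)
  interpret gluing Q P' a b
  proof
    show "\<exists>x\<in>Q. a \<bullet> x < b"
      using neighbours_in(1) inner_a[of "v + p"] by (intro bexI[of _ "v + p"]) (simp_all add: dual)
    show "\<exists>x\<in>P'. b < a \<bullet> x"
    proof -
      obtain p' q' r' A' B' C' v' where "corner p' q' r' A' B' C' P' v'" "apex_above a b v' p' q' r'"
        using P'(1) by (auto simp: peaked_def)
      then have "v' \<in> P'" "b < a \<bullet> v'"
        using corner.apex by (auto simp: apex_above_def)
      then show ?thesis by blast
    qed
    show "\<forall>F. F face_of Q \<and> F \<noteq> Q \<longrightarrow> F \<inter> P' \<subseteq> {x. a \<bullet> x = b}"
      using proper P'(2) by blast
    show "\<forall>x\<in>P'. b \<le> a \<bullet> x"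
      using P'(2) \<open>T \<subseteq> {x. b \<le> a \<bullet> x}\<close> by blast
    show "Q \<inter> {x. a \<bullet> x = b} \<subseteq> P'"
      using G_sub P'(3) by auto
  qed (use polytope3 polyP' P'(2) T_sub in auto)
  have G: "G = cut_face 2 2" "lower = cut 2 2"
    unfolding G_def lower_def cut_face_def cut_def by (simp_all add: a_def b_def)
  have simplex_G: "2 simplex G"
    unfolding G by (rule cut_face_simplex) simp_all
  have G_slice: "P' \<inter> {x. a \<bullet> x = b} = G" "P' \<inter> lower = G"
    using Q_subset Q_ge section_subset by (force simp: G_def lower_def)+
  have "G facet_of P'"
  proof -
    have "P' \<inter> {x. a \<bullet> x = b} face_of P'"
      using convex_parts(2) Q_ge by (intro face_of_Int_supporting_hyperplane_ge) auto
    then show ?thesis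
      using aff_dim_G polyP' G_slice(1) by (auto simp: facet_of_def polytope3_def)
  qed
  then have triangle: "triangle_facet G P'"
    using simplex_G by (simp add: triangle_facet_def)
  \<comment> \<open>\<open>P'\<close> is already in position, so the identity serves as the
    projective transformation.\<close>
  have id: "projective_map id ` X = X" for X :: "(real^3) set"
    by (simp add: projective_map_def)
  have admissible: "admissible_projective id P'"
    by (simp add: admissible_projective_def linear_id)
  have "connected_sum Q P' R"
    unfolding connected_sum_def
  proof (intro conjI exI)
    show "simple_vertex v Q" by (rule simple_vertex)
    show "triangle_facet G P'" by (rule triangle)
    show "b < a \<bullet> v" "\<forall>w. w extreme_point_of Q \<and> w \<noteq> v \<longrightarrow> a \<bullet> w < b"
      using cut_separates by (simp_all add: a_def b_def)
    show "lower = Q \<inter> {x. a \<bullet> x \<le> b}" "G = Q \<inter> {x. a \<bullet> x = b}"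
      by (simp_all add: lower_def G_def)
    show "admissible_projective id P'" by (rule admissible)
    show "projective_map id ` P' \<inter> lower = projective_map id ` G" "projective_map id ` G = G"
      "R = lower \<union> projective_map id ` P'"
      unfolding id by (rule G_slice(2) refl R_def)+
    show "convex R" by (rule convex_R)
    show "\<forall>E. E face_of G \<and> E \<noteq> G \<longrightarrow> E face_of R"
      using face_of_G_imp_face_of_R by blast
  qed (rule polytope3 polyP')+
  moreover have "f_vector R = f_vector Q \<boxplus>'' f_vector P'"
  \<comment> \<open>The cut gains (2, 1) in vertices and facets; gluing then identifies three
    vertices and loses two triangles, which leaves (-1, -1) in total.\<close>
  proof -
    have "face_number lower 0 = face_number Q 0 + 2" "face_number lower 2 = face_number Q 2 + 1"
      using cut_face_numbers[of 2 2] by (simp_all add: G)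
    then have "face_number R 0 + 1 = face_number Q 0 + face_number P' 0"
      "face_number R 2 + 1 = face_number Q 2 + face_number P' 2"
      using face_number_0_R face_number_2_R triangle_face_numbers(1)[OF simplex_G] by linarith+
    then show ?thesis
      using Euler_polytope3[OF polytope3_R] Euler_polytope3[OF polytope3] Euler_polytope3[OF polyP']
      by (simp add: f_vector_def boxplus''_def)
  qed
  ultimately show ?thesis
    using polyP' P'(4) polytope3_R by metis
qed

end

section \<open>Base tetrahedron and semigroup structure\<close>

lemma frame_axis: "frame (axis 1 1) (axis 2 1) (axis 3 1) (axis 1 1) (axis 2 1) (axis 3 (1::real) :: real^3)"
proof
  fix x :: "real^3"
  show "x = (axis 1 1 \<bullet> x) *\<^sub>R axis 1 1 + (axis 2 1 \<bullet> x) *\<^sub>R axis 2 1 + (axis 3 1 \<bullet> x) *\<^sub>R axis 3 1"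
    by (simp add: inner_axis' vec_eq_iff forall_3) (simp add: axis_def)
qed (simp_all add: inner_axis_axis)

lemma corner_realisation:
  assumes "polytope3 P"
  shows "\<exists>p q r A B C Q v. corner p q r A B C Q v \<and> f_vector Q = f_vector P"
proof -
  let ?p = "axis 1 1 :: real^3" and ?q = "axis 2 1 :: real^3" and ?r = "axis 3 1 :: real^3"
  let ?T = "convex hull {0, 0 + ?p, 0 + ?q, 0 + ?r}"
  have "corner ?p ?q ?r ?p ?q ?r ?T 0"
    by (rule frame.corner_simplex[OF frame_axis])
  \<comment> \<open>With \<open>h = 0\<close> and \<open>t = - 1\<close> the protected base is
    empty: the first summand has no facet to preserve.\<close>
  moreover have "apex_above 0 (- 1) 0 ?p ?q ?r"
    by (simp add: apex_above_def)
  ultimately have "peaked 0 (- 1) ?T"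
    unfolding peaked_def by blast
  then obtain Q where "peaked 0 (- 1) Q" "f_vector Q = f_vector P"
    using f_vector_realisation[OF _ frame.face_number_simplex[OF frame_axis] assms] by blast
  then show ?thesis
    unfolding peaked_def by blast
qed

text \<open>Translation by -(1, 0, 1) turns the modified addition into the ordinary one.\<close>

lemma affine_semigroup_f_vectors3:
  assumes "\<And>x y. x \<in> f_vectors3 \<Longrightarrow> y \<in> f_vectors3 \<Longrightarrow> x \<boxplus>'' y \<in> f_vectors3"
  shows "affine_semigroup f_vectors3 (\<boxplus>'')"
proof -
  define \<phi> :: "int \<times> int \<times> int \<Rightarrow> nat \<Rightarrow> int" where
    "\<phi> = (\<lambda>(x, y, z) i. if i = 0 then x - 1 else if i = 1 then y else if i = 2 then z - 1 else 0)"
  have hom: "\<phi> (x \<boxplus>'' y) = (\<lambda>i. \<phi> x i + \<phi> y i)" for x y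
    by (auto simp: \<phi>_def boxplus''_def split: prod.splits)
  have "inj \<phi>"
  proof (rule injI)
    fix x y assume "\<phi> x = \<phi> y"
    then have "\<phi> x 0 = \<phi> y 0" "\<phi> x 1 = \<phi> y 1" "\<phi> x 2 = \<phi> y 2" by simp_all
    then show "x = y" by (auto simp: \<phi>_def split: prod.splits)
  qed
  then have "bij_betw \<phi> f_vectors3 (\<phi> ` f_vectors3)"
    using inj_on_subset by (auto simp: bij_betw_def)
  moreover have "\<phi> ` f_vectors3 \<subseteq> int_tuples 3"
    by (auto simp: \<phi>_def int_tuples_def)
  moreover have "\<forall>s\<in>\<phi> ` f_vectors3. \<forall>t\<in>\<phi> ` f_vectors3. (\<lambda>i. s i + t i) \<in> \<phi> ` f_vectors3"
    using assms by (auto simp flip: hom)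
  ultimately show ?thesis
    unfolding affine_semigroup_def using assms hom
    by (intro conjI exI[of _ 3] exI[of _ "\<phi> ` f_vectors3"] exI[of _ \<phi>]) simp_all
qed

theorem proposition5p7:
  shows "affine_semigroup f_vectors3 (\<boxplus>'') \<and>
    (\<forall>P Q. polytope3 P \<and> polytope3 Q \<longrightarrow>
      (\<exists>P' Q' R. polytope3 P' \<and> polytope3 Q' \<and>
         f_vector P' = f_vector P \<and> f_vector Q' = f_vector Q \<and>
         connected_sum P' Q' R \<and> polytope3 R \<and>
         f_vector R = f_vector P \<boxplus>'' f_vector Q))"
proof -
  have sum: "\<exists>P' Q' R. polytope3 P' \<and> polytope3 Q' \<and> f_vector P' = f_vector P \<and> f_vector Q' = f_vector Q \<and>
      connected_sum P' Q' R \<and> polytope3 R \<and> f_vector R = f_vector P \<boxplus>'' f_vector Q"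
    if P: "polytope3 P" and Q: "polytope3 Q" for P Q
  proof -
    \<comment> \<open>Only the first summand is chosen here; \<open>connected_sum_exists\<close>
      supplies a matching second one with the \<open>f\<close>-vector of \<open>Q\<close>.\<close>
    obtain p q r A B C P' v where P': "corner p q r A B C P' v" "f_vector P' = f_vector P"
      using corner_realisation[OF P] by blast
    show ?thesis
      using corner.connected_sum_exists[OF P'(1) Q] corner.polytope3[OF P'(1)] P'(2) by metis
  qed
  have "x \<boxplus>'' y \<in> f_vectors3" if xy: "x \<in> f_vectors3" "y \<in> f_vectors3" for x y
  proof -
    obtain P Q where PQ: "x = f_vector P" "polytope3 P" "y = f_vector Q" "polytope3 Q"
      using xy by (auto simp: f_vectors3_def)
    then obtain R where "polytope3 R" "f_vector R = x \<boxplus>'' y"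
      using sum[of P Q] by metis
    then show ?thesis
      unfolding f_vectors3_def by (metis (mono_tags, lifting) mem_Collect_eq)
  qed
  then have "affine_semigroup f_vectors3 (\<boxplus>'')"
    by (rule affine_semigroup_f_vectors3)
  with sum show ?thesis by blast
qed

end
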